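(* Let $p\in\mathbb{C}$ with $\Re(p)>0$ and let $\gamma>0$ be real. Then $$S_{0,p}(\gamma)=2\sqrt{p}\,\sum_{k\ge1}\left(\frac{K_1\left(2\sqrt{p(k+\mathrm{i}\gamma)}\right)}{\sqrt{k+\mathrm{i}\gamma}}+\frac{K_1\left(2\sqrt{p(k-\mathrm{i}\gamma)}\right)}{\sqrt{k-\mathrm{i}\gamma}}\right)$$ and $$S_{1,p}(\gamma)=\frac{p\,\mathrm{i}}{\gamma}\sum_{k\ge1}\left(\frac{K_2\left(2\sqrt{p(k+\mathrm{i}\gamma)}\right)}{k+\mathrm{i}\gamma}-\frac{K_2\left(2\sqrt{p(k-\mathrm{i}\gamma)}\right)}{k-\mathrm{i}\gamma}\right).$$
   Context: $\mathrm{i}$ is the imaginary unit, $K_\nu$ is the modified Bessel function of the second kind, $J_\nu$ is the Bessel function of the first kind; all roots are principal. The $p$-extended Mathieu series is $S_{\mu,p}(r)=2\sum_{n\ge0}(-1)^n r^{2n}\binom{\mu+n}{n}\zeta_p(2\mu+2n+1)$, where $\zeta_p(s)=\frac1{\Gamma(s)}\int_0^\infty\frac{t^{s-1}e^{-p/t}}{e^t-1}\,dt$ is the $p$-extended Riemann zeta function. For all $r>0$, $\mu>-1$ and $\Re(p)>0$ it is understood through its integral form $$S_{\mu,p}(r)=\frac{\sqrt\pi}{(2r)^{\mu-\frac12}\Gamma(\mu+1)}\int_0^\infty\frac{t^{\mu+\frac12}e^{-p/t}}{e^t-1}J_{\mu-\frac12}(rt)\,dt .$$ *)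

theory Defs
  imports "HOL-Analysis.Analysis"
begin

text \<open>
  The Bessel functions are given by their defining power series, with the principal branch of the
  power. The function \<open>rGamma\<close> is the entire reciprocal Gamma function, which vanishes at the
  nonpositive integers. Since \<open>0 powr a = 0\<close> for every \<open>a\<close>, these definitions give \<open>0\<close> at \<open>z = 0\<close>
  also for order \<open>0\<close>; they are meant for nonzero arguments.
\<close>

definition bessel_J :: "real \<Rightarrow> complex \<Rightarrow> complex" where
  "bessel_J \<nu> z = (z / 2) powr of_real \<nu> *
     (\<Sum>m. (- 1) ^ m * of_real (rGamma (real m + \<nu> + 1)) / fact m * (z / 2) ^ (2 * m))"

definition bessel_I :: "real \<Rightarrow> complex \<Rightarrow> complex" where
  "bessel_I \<nu> z = (z / 2) powr of_real \<nu> *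
     (\<Sum>m. of_real (rGamma (real m + \<nu> + 1)) / fact m * (z / 2) ^ (2 * m))"

text \<open>
  For integer order the usual quotient is of the form \<open>0 / 0\<close>, and \<open>K\<close> is by convention its limit
  as the order tends to that integer.
\<close>

definition bessel_K :: "real \<Rightarrow> complex \<Rightarrow> complex" where
  "bessel_K \<nu> z =
     (let q = (\<lambda>\<alpha>::real. of_real pi / 2 * (bessel_I (- \<alpha>) z - bessel_I \<alpha> z) / of_real (sin (\<alpha> * pi)))
      in if \<nu> \<in> \<int> then Lim (at \<nu>) q else q \<nu>)"

text \<open>
  The \<open>p\<close>-extended Mathieu series, in the integral form through which it is understood for all
  \<open>r > 0\<close>, \<open>\<mu> > -1\<close>, \<open>Re p > 0\<close> (its expansion in powers of \<open>r\<close> need not converge there).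
\<close>

definition mathieu_S :: "real \<Rightarrow> complex \<Rightarrow> real \<Rightarrow> complex" where
  "mathieu_S \<mu> p r =
     of_real (sqrt pi / ((2 * r) powr (\<mu> - 1 / 2) * Gamma (\<mu> + 1))) *
     (LBINT t:{0<..}. of_real (t powr (\<mu> + 1 / 2)) * exp (- p / of_real t) / of_real (exp t - 1) *
        bessel_J (\<mu> - 1 / 2) (of_real (r * t)))"

end

theory Submission
  imports Defs "HOL-Real_Asymp.Real_Asymp"
begin

text \<open>
  Since \<open>J\<^bsub>-1/2\<^esub>\<close> and \<open>J\<^bsub>1/2\<^esub>\<close> are elementary, \<open>S\<^bsub>0,p\<^esub>\<close> and \<open>S\<^bsub>1,p\<^esub>\<close> are the integrals over \<open>t > 0\<close> of
  \<open>2 cos (\<gamma>t) e\<^bsup>-p/t\<^esup> / (e\<^bsup>t\<^esup> - 1)\<close> and \<open>t sin (\<gamma>t) e\<^bsup>-p/t\<^esup> / (\<gamma> (e\<^bsup>t\<^esup> - 1))\<close>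
  (\<open>mathieu_S_0\<close>, \<open>mathieu_S_1\<close>). Expanding \<open>1 / (e\<^bsup>t\<^esup> - 1)\<close> as the geometric series of the \<open>e\<^bsup>-kt\<^esup>\<close>,
  \<open>k \<ge> 1\<close>, and writing the trigonometric factor as a combination of \<open>e\<^bsup>i\<gamma>t\<^esup>\<close> and \<open>e\<^bsup>-i\<gamma>t\<^esup>\<close> turns them into
  sums of integrals \<open>F s p a\<close>, the integral of \<open>t\<^bsup>s-1\<^esup> e\<^bsup>-p/t-at\<^esup>\<close>, with \<open>a = k \<plusminus> i\<gamma>\<close> and \<open>s = 1\<close> or
  \<open>s = 2\<close>; dominated convergence of the partial sums justifies the exchange (\<open>bessel_integral_sums\<close>).
  Everything then rests on the classical formula \<open>F s p a = 2 (p/a)\<^bsup>s/2\<^esup> K\<^sub>s (2 \<surd>(pa))\<close> at \<open>s = 1, 2\<close>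
  (\<open>bessel_K_1\<close>, \<open>bessel_K_2\<close>).

  That formula has to be reached from \<open>K\<close> as a limit of quotients of power series. For non-integer
  order \<open>\<alpha>\<close> the claim is the connection formula
  \<open>sin (\<pi>\<alpha>) F \<alpha> p a = \<pi> (a\<^bsup>-\<alpha>\<^esup> A\<^bsub>-\<alpha>\<^esub>(ap) - p\<^bsup>\<alpha>\<^esup> A\<^sub>\<alpha>(ap))\<close>, where \<open>A\<^sub>\<alpha>\<close> is the entire power series inside
  \<open>I\<^sub>\<alpha>\<close>. Along the ray \<open>x p\<close>, \<open>x > 0\<close>, the pair \<open>(F \<alpha>, F (\<alpha> - 1))\<close> and the two pairs built from
  \<open>A\<^bsub>-\<alpha>\<^esub>\<close> and \<open>A\<^sub>\<alpha>\<close> solve the same linear first-order system, so \<open>x\<^bsup>1-\<alpha>\<^esup>\<close> times the Wronskian of any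
  two of them is constant and can be read off as \<open>x \<rightarrow> 0\<close>. For \<open>0 < \<alpha> < 1\<close> these limits are Gamma
  values, and the three Wronskians determine both components of the integral pair
  (\<open>bessel_connection_unit\<close>). The three-term recurrence in the order carries the formula to the other
  non-integer orders in \<open>(0, 3)\<close>, and continuity of \<open>F\<close> in the order gives the limits at \<open>1\<close> and \<open>2\<close>
  from both sides (\<open>bessel_K_integral\<close>).
\<close>

section \<open>Limits and derivatives of parameter integrals\<close>

lemma set_integral_dominated_convergence_sequence:
  fixes f :: "nat \<Rightarrow> 'a \<Rightarrow> 'c::{banach, second_countable_topology}"
  assumes meas: "\<And>i. set_borel_measurable M A (f i)" "set_borel_measurable M A g"
    and w: "set_integrable M A w"
    and bound: "\<And>i t. t \<in> A \<Longrightarrow> norm (f i t) \<le> w t"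
    and lim: "\<And>t. t \<in> A \<Longrightarrow> (\<lambda>i. f i t) \<longlonglongrightarrow> g t"
  shows "(\<lambda>i. LINT t:A|M. f i t) \<longlonglongrightarrow> (LINT t:A|M. g t)"
  using meas w bound lim
  unfolding set_lebesgue_integral_def set_borel_measurable_def set_integrable_def
  by (intro integral_dominated_convergence[where w = "\<lambda>t. indicator A t *\<^sub>R w t"])
    (auto simp: indicator_def intro!: AE_I2)

lemma set_integral_dominated_convergence_at:
  fixes f :: "'b::first_countable_topology \<Rightarrow> 'a \<Rightarrow> 'c::{banach, second_countable_topology}"
  assumes meas: "\<And>y. y \<in> S - {x} \<Longrightarrow> set_borel_measurable M A (f y)" "set_borel_measurable M A g"
    and w: "set_integrable M A w"
    and bound: "\<And>y t. y \<in> S - {x} \<Longrightarrow> t \<in> A \<Longrightarrow> norm (f y t) \<le> w t"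
    and lim: "\<And>t. t \<in> A \<Longrightarrow> ((\<lambda>y. f y t) \<longlongrightarrow> g t) (at x within S)"
  shows "((\<lambda>y. LINT t:A|M. f y t) \<longlongrightarrow> (LINT t:A|M. g t)) (at x within S)"
  unfolding tendsto_at_iff_sequentially o_def
proof (intro allI impI)
  fix X assume X: "\<forall>i. X i \<in> S - {x}" "X \<longlonglongrightarrow> x"
  have "(\<lambda>i. f (X i) t) \<longlonglongrightarrow> g t" if "t \<in> A" for t
    using lim[OF that] X unfolding tendsto_at_iff_sequentially o_def by blast
  then show "(\<lambda>i. LINT t:A|M. f (X i) t) \<longlonglongrightarrow> (LINT t:A|M. g t)"
    using X(1) by (intro set_integral_dominated_convergence_sequence[where w = w] meas w bound) auto
qed

lemma norm_exp_diff_le: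
  fixes z w :: complex and c d :: real
  assumes "c \<ge> 0" "Re z \<ge> d" "Re w \<ge> d"
  shows "norm (exp (- z * of_real c) - exp (- w * of_real c)) \<le> c * exp (- d * c) * norm (z - w)"
proof (rule field_differentiable_bound)
  show "convex {z. Re z \<ge> d}" by (rule convex_halfspace_Re_ge)
  fix y assume y: "y \<in> {z. Re z \<ge> d}"
  show "((\<lambda>z. exp (- z * of_real c)) has_field_derivative - of_real c * exp (- y * of_real c)) (at y within {z. Re z \<ge> d})"
    by (auto intro!: derivative_eq_intros)
  show "norm (- of_real c * exp (- y * of_real c)) \<le> c * exp (- d * c)"
    using y assms(1) by (auto simp: norm_mult mult_right_mono intro!: mult_left_mono)
qed (use assms in auto)

text \<open>
  Differentiation under the integral for a Laplace-type transform with general exponent \<open>\<phi>\<close>. With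
  \<open>\<phi> t = t\<close> it serves the parameter \<open>a\<close> of the Bessel integral, with \<open>\<phi> t = 1 / t\<close> the parameter \<open>p\<close>.
  On the half plane \<open>Re w > Re z / 2\<close> the difference quotients are dominated by the mean value
  inequality \<open>norm_exp_diff_le\<close>.
\<close>

lemma has_field_derivative_laplace_integral:
  fixes h :: "'a \<Rightarrow> complex" and \<phi> :: "'a \<Rightarrow> real" and z :: complex
  assumes \<phi>: "\<And>t. t \<in> A \<Longrightarrow> \<phi> t \<ge> 0"
    and int: "\<And>z. Re z > 0 \<Longrightarrow> set_integrable M A (\<lambda>t. h t * exp (- z * of_real (\<phi> t)))"
    and int': "\<And>z. Re z > 0 \<Longrightarrow> set_integrable M A (\<lambda>t. h t * of_real (\<phi> t) * exp (- z * of_real (\<phi> t)))"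
    and z: "Re z > 0"
  shows "((\<lambda>z. LINT t:A|M. h t * exp (- z * of_real (\<phi> t))) has_field_derivative
           - (LINT t:A|M. h t * of_real (\<phi> t) * exp (- z * of_real (\<phi> t)))) (at z)"
proof -
  define d where "d = Re z / 2"
  have d: "d > 0" "Re z > d" using z by (auto simp: d_def)
  define S where "S = {w. Re w > d}"
  have "open S" "z \<in> S" using d by (auto simp: S_def open_halfspace_Re_gt)
  define e where "e = (\<lambda>y t. exp (- y * of_real (\<phi> t)) :: complex)"
  have eq: "((LINT t:A|M. h t * e y t) - (LINT t:A|M. h t * e z t)) / (y - z) =
            (LINT t:A|M. h t * (e y t - e z t) / (y - z))" if "y \<in> S" for y
    using int[of y] int[of z] z that d unfolding S_def e_def
    by (simp add: right_diff_distrib)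
  have "((\<lambda>y. LINT t:A|M. h t * (e y t - e z t) / (y - z)) \<longlongrightarrow>
         (LINT t:A|M. - (h t * of_real (\<phi> t) * e z t))) (at z within S)"
  proof (rule set_integral_dominated_convergence_at[where w = "\<lambda>t. norm (h t * of_real (\<phi> t) * exp (- of_real d * of_real (\<phi> t)))"])
    fix y assume y: "y \<in> S - {z}"
    have "set_integrable M A (\<lambda>t. h t * (e y t - e z t) / (y - z))"
      using int[of y] int[of z] z y d unfolding S_def e_def
      by (simp add: right_diff_distrib)
    then show "set_borel_measurable M A (\<lambda>t. h t * (e y t - e z t) / (y - z))"
      unfolding set_integrable_def set_borel_measurable_def by (rule borel_measurable_integrable)
    fix t assume t: "t \<in> A"
    have "norm (e y t - e z t) \<le> \<phi> t * exp (- d * \<phi> t) * norm (y - z)"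
      unfolding e_def using y d t \<phi> by (intro norm_exp_diff_le) (auto simp: S_def)
    then have "norm (e y t - e z t) / norm (y - z) \<le> \<phi> t * exp (- d * \<phi> t)"
      using y by (simp add: field_simps)
    then have "norm (h t) * (norm (e y t - e z t) / norm (y - z)) \<le> norm (h t) * (\<phi> t * exp (- d * \<phi> t))"
      by (intro mult_left_mono) auto
    then show "norm (h t * (e y t - e z t) / (y - z)) \<le> norm (h t * of_real (\<phi> t) * exp (- of_real d * of_real (\<phi> t)))"
      using \<phi>[OF t] by (simp add: norm_mult norm_divide mult.assoc)
  next
    have "set_integrable M A (\<lambda>t. - (h t * of_real (\<phi> t) * e z t))"
      using int'[OF z] unfolding e_def set_integrable_def by simp
    then show "set_borel_measurable M A (\<lambda>t. - (h t * of_real (\<phi> t) * e z t))"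
      unfolding set_integrable_def set_borel_measurable_def by (rule borel_measurable_integrable)
    show "set_integrable M A (\<lambda>t. norm (h t * of_real (\<phi> t) * exp (- of_real d * of_real (\<phi> t))))"
      using int'[of "of_real d"] d by (intro set_integrable_norm) auto
    fix t
    have "((\<lambda>y. e y t) has_field_derivative - of_real (\<phi> t) * e z t) (at z within S)"
      unfolding e_def by (auto intro!: derivative_eq_intros)
    then have "((\<lambda>y. h t * ((e y t - e z t) / (y - z))) \<longlongrightarrow> h t * (- of_real (\<phi> t) * e z t)) (at z within S)"
      unfolding has_field_derivative_iff by (intro tendsto_intros)
    then show "((\<lambda>y. h t * (e y t - e z t) / (y - z)) \<longlongrightarrow> - (h t * of_real (\<phi> t) * e z t)) (at z within S)"
      by (simp add: mult.assoc)
  qed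
  note lim = this
  have ev: "\<forall>\<^sub>F y in at z within S. (LINT t:A|M. h t * (e y t - e z t) / (y - z)) =
      ((LINT t:A|M. h t * e y t) - (LINT t:A|M. h t * e z t)) / (y - z)"
    unfolding eventually_at_filter using eq by (intro always_eventually) metis
  have neg: "(LINT t:A|M. - (h t * of_real (\<phi> t) * e z t)) = - (LINT t:A|M. h t * of_real (\<phi> t) * e z t)"
    by (simp add: set_lebesgue_integral_def)
  have "((\<lambda>y. ((LINT t:A|M. h t * e y t) - (LINT t:A|M. h t * e z t)) / (y - z)) \<longlongrightarrow>
         - (LINT t:A|M. (h t * of_real (\<phi> t) * e z t))) (at z within S)"
    by (rule iffD1[OF tendsto_cong[OF ev] lim[unfolded neg]])
  then show ?thesis
    unfolding has_field_derivative_iff e_def at_within_open[OF \<open>z \<in> S\<close> \<open>open S\<close>] .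
qed

section \<open>The Bessel integral\<close>

definition bessel_kernel :: "real \<Rightarrow> complex \<Rightarrow> complex \<Rightarrow> real \<Rightarrow> complex" where
  "bessel_kernel s p a t = of_real (t powr (s - 1)) * exp (- (p / of_real t) - a * of_real t)"

definition bessel_integral :: "real \<Rightarrow> complex \<Rightarrow> complex \<Rightarrow> complex" where
  "bessel_integral s p a = (LBINT t:{0<..}. bessel_kernel s p a t)"

text \<open>
  These conditions make the kernel integrable: decay at infinity comes from \<open>Re a > 0\<close>, integrability
  at the origin from \<open>Re p > 0\<close> or, in the Gamma case \<open>p = 0\<close>, from \<open>s > 0\<close>. The case \<open>p = 0\<close> is
  included because \<open>bessel_integral s 0 a\<close> is the boundary value as \<open>p \<rightarrow> 0\<close>.
\<close>

definition bessel_admissible :: "real \<Rightarrow> complex \<Rightarrow> complex \<Rightarrow> bool" where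
  "bessel_admissible s p a \<longleftrightarrow> Re a > 0 \<and> (Re p > 0 \<or> p = 0 \<and> s > 0)"

lemma norm_bessel_kernel:
  "t > 0 \<Longrightarrow> norm (bessel_kernel s p a t) = t powr (s - 1) * exp (- (Re p / t) - Re a * t)"
  by (simp add: bessel_kernel_def norm_mult)

lemma bessel_kernel_shift:
  "t > 0 \<Longrightarrow> bessel_kernel (s + 1) p a t = of_real t * bessel_kernel s p a t"
  "t > 0 \<Longrightarrow> bessel_kernel (s - 1) p a t = bessel_kernel s p a t / of_real t"
  by (simp_all add: bessel_kernel_def powr_diff powr_add power2_eq_square)

lemma bessel_kernel_measurable:
  "set_borel_measurable lborel {0<..} (bessel_kernel s p a)"
  unfolding set_borel_measurable_def bessel_kernel_def by measurable

lemma Gamma_kernel_integrable: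
  fixes s c :: real
  assumes "s > 0" "c > 0"
  shows "set_integrable lborel {0<..} (\<lambda>t. t powr (s - 1) * exp (- c * t))"
proof -
  have "(\<lambda>t. complex_of_real t powr (of_real s - 1) / of_real (exp (c * t))) absolutely_integrable_on {0<..}"
    using assms by (intro absolutely_integrable_Gamma_integral) auto
  then have "set_integrable lebesgue {0<..} (\<lambda>t. norm (complex_of_real t powr (of_real s - 1) / of_real (exp (c * t))))"
    by (rule set_integrable_norm)
  also have "?this \<longleftrightarrow> set_integrable lebesgue {0<..} (\<lambda>t. t powr (s - 1) * exp (- c * t))"
    by (intro set_integrable_cong) (auto simp: norm_divide exp_minus field_simps norm_powr_real_powr)
  also have "\<dots> \<longleftrightarrow> set_integrable lborel {0<..} (\<lambda>t. t powr (s - 1) * exp (- c * t))"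
    unfolding set_integrable_def by (rule integrable_completion) measurable
  finally show ?thesis .
qed

lemma exp_minus_inverse_le:
  fixes x t :: real
  assumes "x > 0" "t > 0"
  shows "exp (- (x / t)) \<le> fact m / x ^ m * t ^ m"
proof -
  have "(\<Sum>i\<in>{m}. (x / t) ^ i /\<^sub>R fact i) \<le> exp (x / t)"
    unfolding exp_def by (intro sum_le_suminf summable_exp_generic) (use assms in auto)
  then show ?thesis
    using assms by (simp add: exp_minus field_simps)
qed


text \<open>
  The factor \<open>e\<^bsup>-p/t\<^esup>\<close> vanishes at the origin faster than any power of \<open>t\<close>, so a kernel of arbitrary
  real order is dominated by a Gamma integrand of positive order \<open>\<sigma>\<close>.
\<close>

lemma norm_bessel_kernel_le:
  assumes "bessel_admissible s p a"
  obtains C \<sigma> where "C \<ge> 0" "\<sigma> > 0"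
    "\<And>t. t > 0 \<Longrightarrow> norm (bessel_kernel s p a t) \<le> C * (t powr (\<sigma> - 1) * exp (- Re a * t))"
proof (cases "p = 0")
  case True
  then show ?thesis
    using assms that[of 1 s] by (auto simp: bessel_admissible_def norm_bessel_kernel)
next
  case False
  then have p: "Re p > 0" using assms by (auto simp: bessel_admissible_def)
  \<comment> \<open>Trading the exponential factor for \<open>t ^ m\<close> lifts the order from \<open>s\<close> to \<open>s + m > 0\<close>.\<close>
  obtain m :: nat where m: "real m > - s" using reals_Archimedean2 by blast
  show ?thesis
  proof (rule that[of "fact m / Re p ^ m" "s + real m"])
    fix t :: real assume t: "t > 0"
    have "norm (bessel_kernel s p a t) = t powr (s - 1) * exp (- (Re p / t)) * exp (- Re a * t)"
      using t by (simp add: norm_bessel_kernel flip: exp_add)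
    also have "\<dots> \<le> t powr (s - 1) * (fact m / Re p ^ m * t ^ m) * exp (- Re a * t)"
      using exp_minus_inverse_le[OF p t] by (intro mult_left_mono mult_right_mono) auto
    also have "\<dots> = fact m / Re p ^ m * (t powr (s + real m - 1) * exp (- Re a * t))"
      using t by (simp add: powr_add powr_diff powr_realpow mult_ac)
    finally show "norm (bessel_kernel s p a t) \<le> \<dots>" .
  qed (use p m in auto)
qed

lemma bessel_kernel_integrable:
  assumes "bessel_admissible s p a"
  shows "set_integrable lborel {0<..} (bessel_kernel s p a)"
proof -
  obtain C \<sigma> where C: "C \<ge> 0" "\<sigma> > 0"
    "\<And>t. t > 0 \<Longrightarrow> norm (bessel_kernel s p a t) \<le> C * (t powr (\<sigma> - 1) * exp (- Re a * t))"
    using norm_bessel_kernel_le[OF assms] by blast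
  have "set_integrable lborel {0<..} (\<lambda>t. C * (t powr (\<sigma> - 1) * exp (- Re a * t)))"
    using C(2) assms by (intro set_integrable_mult_right Gamma_kernel_integrable) (auto simp: bessel_admissible_def)
  then show ?thesis
    by (rule set_integrable_bound[OF _ bessel_kernel_measurable]) (use C in \<open>auto intro!: AE_I2 intro: order_trans[OF _ abs_ge_self]\<close>)
qed

lemma bessel_integral_0_1:
  assumes "s > 0"
  shows "bessel_integral s 0 1 = of_real (Gamma s)"
proof -
  have "bessel_integral s 0 1 = integral {0<..} (bessel_kernel s 0 1)"
    unfolding bessel_integral_def
    by (rule set_borel_integral_eq_integral(2), rule bessel_kernel_integrable)
      (use assms in \<open>auto simp: bessel_admissible_def\<close>)
  also have "(bessel_kernel s 0 1 has_integral Gamma (of_real s)) {0<..}"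
  proof (rule has_integral_eq[OF _ Gamma_integral_complex'])
    fix t :: real assume "t \<in> {0<..}"
    then show "of_real t powr (of_real s - 1) / of_real (exp t) = bessel_kernel s 0 1 t"
      using powr_of_real[of t "s - 1"] by (simp add: bessel_kernel_def exp_minus divide_inverse exp_of_real)
  qed (use assms in simp)
  then have "integral {0<..} (bessel_kernel s 0 1) = Gamma (of_real s)"
    by (rule integral_unique)
  finally show ?thesis by (simp add: Gamma_complex_of_real)
qed

lemma bessel_integral_deriv_a:
  assumes "bessel_admissible s p a"
  shows "(bessel_integral s p has_field_derivative - bessel_integral (s + 1) p a) (at a)"
proof -
  define h where "h = (\<lambda>t. of_real (t powr (s - 1)) * exp (- (p / of_real t)) :: complex)"
  have k: "bessel_kernel s p z t = h t * exp (- z * of_real t)"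
          "t > 0 \<Longrightarrow> bessel_kernel (s + 1) p z t = h t * of_real t * exp (- z * of_real t)" for z t
    by (simp_all add: h_def bessel_kernel_shift) (simp_all add: bessel_kernel_def flip: exp_add)
  have adm: "bessel_admissible s p z" "bessel_admissible (s + 1) p z" if "Re z > 0" for z
    using that assms by (auto simp: bessel_admissible_def)
  have k': "set_integrable lborel {0<..} (\<lambda>t. h t * of_real t * exp (- z * of_real t))" if "Re z > 0" for z
    using bessel_kernel_integrable[OF adm(2)[OF that]] by (subst (asm) set_integrable_cong[OF refl refl]) (auto simp: k(2))
  have "((\<lambda>z. LINT t:{0<..}|lborel. h t * exp (- z * of_real t)) has_field_derivative
           - (LINT t:{0<..}|lborel. h t * of_real t * exp (- a * of_real t))) (at a)"
    using assms unfolding bessel_admissible_def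
    by (intro has_field_derivative_laplace_integral[OF _ bessel_kernel_integrable[OF adm(1), unfolded ext[OF k(1)]] k']) auto
  also have "(LINT t:{0<..}|lborel. h t * of_real t * exp (- a * of_real t)) = bessel_integral (s + 1) p a"
    unfolding bessel_integral_def by (rule set_lebesgue_integral_cong) (auto simp: k(2))
  finally show ?thesis
    unfolding bessel_integral_def[abs_def] k(1) .
qed

lemma bessel_integral_deriv_p:
  assumes "Re p > 0" "Re a > 0"
  shows "((\<lambda>p. bessel_integral s p a) has_field_derivative - bessel_integral (s - 1) p a) (at p)"
proof -
  define h where "h = (\<lambda>t. of_real (t powr (s - 1)) * exp (- (a * of_real t)) :: complex)"
  have e: "exp (- (z / of_real t) - a * of_real t) = exp (- (a * of_real t)) * exp (- z * of_real (1 / t))" for z t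
    unfolding exp_add[symmetric] by (rule arg_cong[where f = exp]) simp
  have k: "bessel_kernel s z a t = h t * exp (- z * of_real (1 / t))"
          "t > 0 \<Longrightarrow> bessel_kernel (s - 1) z a t = h t * of_real (1 / t) * exp (- z * of_real (1 / t))" for z t
    by (simp_all add: bessel_kernel_shift) (simp_all add: bessel_kernel_def e h_def)
  have adm: "bessel_admissible s z a" if "Re z > 0" for z s
    using that assms by (auto simp: bessel_admissible_def)
  have k': "set_integrable lborel {0<..} (\<lambda>t. h t * of_real (1 / t) * exp (- z * of_real (1 / t)))" if "Re z > 0" for z
    using bessel_kernel_integrable[OF adm[OF that, of "s - 1"]] by (subst (asm) set_integrable_cong[OF refl refl]) (auto simp: k(2))
  have "((\<lambda>z. LINT t:{0<..}|lborel. h t * exp (- z * of_real (1 / t))) has_field_derivative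
           - (LINT t:{0<..}|lborel. h t * of_real (1 / t) * exp (- p * of_real (1 / t)))) (at p)"
    using assms
    by (intro has_field_derivative_laplace_integral[OF _ bessel_kernel_integrable[OF adm[where s = s], unfolded ext[OF k(1)]] k']) auto
  also have "(LINT t:{0<..}|lborel. h t * of_real (1 / t) * exp (- p * of_real (1 / t))) = bessel_integral (s - 1) p a"
    unfolding bessel_integral_def by (rule set_lebesgue_integral_cong) (auto simp: k(2))
  finally show ?thesis
    unfolding bessel_integral_def[abs_def] k(1) .
qed

lemma bessel_boundary_term_tendsto_0:
  assumes "bessel_admissible s p a"
  shows "((\<lambda>t. of_real (t powr s) * exp (- (p / of_real t) - a * of_real t)) \<longlongrightarrow> (0::complex)) (at_right 0)"
    and "((\<lambda>t. of_real (t powr s) * exp (- (p / of_real t) - a * of_real t)) \<longlongrightarrow> (0::complex)) at_top"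
proof -
  define x y where "x = Re p" and "y = Re a"
  have y: "y > 0" and x: "x > 0 \<or> x = 0 \<and> s > 0"
    using assms by (auto simp: bessel_admissible_def x_def y_def)
  have n: "norm (of_real (t powr s) * exp (- (p / of_real t) - a * of_real t)) = t powr s * exp (- (x / t) - y * t)" for t
    by (simp add: norm_mult x_def y_def)
  have "((\<lambda>t. t powr s * exp (- (x / t) - y * t)) \<longlongrightarrow> 0) (at_right 0)"
    using x
  proof
    assume "x > 0"
    with y show ?thesis by real_asymp
  next
    assume "x = 0 \<and> s > 0"
    with y show ?thesis by (auto, real_asymp)
  qed
  then show "((\<lambda>t. of_real (t powr s) * exp (- (p / of_real t) - a * of_real t)) \<longlongrightarrow> (0::complex)) (at_right 0)"
    by (subst tendsto_norm_zero_iff[symmetric]) (simp only: n)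
  have "((\<lambda>t. t powr s * exp (- (x / t) - y * t)) \<longlongrightarrow> 0) at_top"
    using y by real_asymp
  then show "((\<lambda>t. of_real (t powr s) * exp (- (p / of_real t) - a * of_real t)) \<longlongrightarrow> (0::complex)) at_top"
    by (subst tendsto_norm_zero_iff[symmetric]) (simp only: n)
qed

text \<open>
  Integrate the derivative of \<open>t\<^bsup>s\<^esup> e\<^bsup>-p/t-at\<^esup>\<close> over the half line: the boundary terms vanish.
\<close>

lemma bessel_integral_recurrence:
  assumes "bessel_admissible s p a"
  shows "a * bessel_integral (s + 1) p a = of_real s * bessel_integral s p a + p * bessel_integral (s - 1) p a"
proof -
  define F where "F = (\<lambda>t. of_real (t powr s) * exp (- (p / of_real t) - a * of_real t) :: complex)"
  define f where "f = (\<lambda>t. of_real s * bessel_kernel s p a t + p * bessel_kernel (s - 1) p a t - a * bessel_kernel (s + 1) p a t)"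
  have i1: "set_integrable lborel {0<..} (\<lambda>t. of_real s * bessel_kernel s p a t)"
    using bessel_kernel_integrable[OF assms] by (rule set_integrable_mult_right)
  have i2: "set_integrable lborel {0<..} (\<lambda>t. a * bessel_kernel (s + 1) p a t)"
    by (rule set_integrable_mult_right, rule bessel_kernel_integrable) (use assms in \<open>auto simp: bessel_admissible_def\<close>)
  have i3: "set_integrable lborel {0<..} (\<lambda>t. p * bessel_kernel (s - 1) p a t)"
  proof (cases "p = 0")
    case False
    then show ?thesis
      by (intro set_integrable_mult_right bessel_kernel_integrable) (use assms in \<open>auto simp: bessel_admissible_def\<close>)
  qed (simp add: set_integrable_def)
  have i: "set_integrable lborel {0<..} f"
    unfolding f_def using i1 i2 i3 by (intro set_integral_diff set_integral_add)
  have e: "einterval 0 \<infinity> = {0<..}" by (auto simp: einterval_def)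
  have "(LBINT t=0..\<infinity>. f t) = 0 - 0"
  proof (rule interval_integral_FTC_integrable[where F = F])
    fix t :: real assume "0 < ereal t"
    then have t: "t > 0" by simp
    have "((\<lambda>t. exp (- (p / of_real t) - a * of_real t)) has_vector_derivative
        (p / of_real t ^ 2 - a) * exp (- (p / of_real t) - a * of_real t)) (at t)"
    proof -
      have "((\<lambda>z. exp (- (p / z) - a * z)) has_field_derivative
        (p / of_real t ^ 2 - a) * exp (- (p / of_real t) - a * of_real t)) (at (of_real t))"
        by (rule DERIV_fun_exp[THEN DERIV_cong] DERIV_diff DERIV_minus DERIV_cmult DERIV_ident DERIV_cdivide
              DERIV_divide DERIV_const)+ (use t in \<open>simp_all add: power2_eq_square\<close>)
      then show ?thesis by (rule has_vector_derivative_real_field)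
    qed
    moreover have "((\<lambda>t. of_real (t powr s) :: complex) has_vector_derivative of_real (s * t powr (s - 1))) (at t)"
      using t by (intro has_vector_derivative_of_real has_real_derivative_powr)
    ultimately have "(F has_vector_derivative
        of_real (t powr s) * ((p / of_real t ^ 2 - a) * exp (- (p / of_real t) - a * of_real t))
      + of_real (s * t powr (s - 1)) * exp (- (p / of_real t) - a * of_real t)) (at t)"
      unfolding F_def by (intro has_vector_derivative_mult)
    also have "of_real (t powr s) * ((p / of_real t ^ 2 - a) * exp (- (p / of_real t) - a * of_real t))
      + of_real (s * t powr (s - 1)) * exp (- (p / of_real t) - a * of_real t) = f t"
      using t by (simp add: f_def bessel_kernel_def powr_diff power2_eq_square field_simps)
    finally show "(F has_vector_derivative f t) (at t)" .
    show "isCont f t"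
      unfolding f_def bessel_kernel_def using t by (intro continuous_intros) auto
  next
    show "set_integrable lborel (einterval 0 \<infinity>) f" using i by (simp add: e)
    show "((F \<circ> real_of_ereal) \<longlongrightarrow> 0) (at_right 0)"
      using bessel_boundary_term_tendsto_0(1)[OF assms] unfolding F_def zero_ereal_def
      by (simp add: ereal_tendsto_simps)
    show "((F \<circ> real_of_ereal) \<longlongrightarrow> 0) (at_left \<infinity>)"
      using bessel_boundary_term_tendsto_0(2)[OF assms] unfolding F_def
      by (simp add: ereal_tendsto_simps)
  qed auto
  also have "(LBINT t=0..\<infinity>. f t) = (LBINT t:{0<..}. f t)"
    by (simp add: interval_lebesgue_integral_def e)
  also have "\<dots> = of_real s * bessel_integral s p a + p * bessel_integral (s - 1) p a - a * bessel_integral (s + 1) p a"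
    using i1 i2 i3 unfolding f_def by (simp add: bessel_integral_def set_integral_diff set_integral_add)
  finally show ?thesis by (simp add: algebra_simps)
qed

section \<open>Values, reflection and continuity of the Bessel integral\<close>

text \<open>
  The Gamma integral with complex rate \<open>a\<close>: by the recurrence at \<open>p = 0\<close>, the derivative of
  \<open>a\<^bsup>s\<^esup> F s 0 a\<close> in \<open>a\<close> is zero on the half plane, and at \<open>a = 1\<close> the value is \<open>\<Gamma>(s)\<close>.
\<close>

lemma bessel_integral_0:
  assumes "s > 0" "Re a > 0"
  shows "bessel_integral s 0 a = of_real (Gamma s) * a powr (- of_real s)"
proof -
  define h where "h = (\<lambda>a. a powr of_real s * bessel_integral s 0 a)"
  have "\<exists>c. \<forall>x\<in>{z. Re z > 0}. h x = c"
  proof (rule has_field_derivative_zero_constant)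
    fix z assume "z \<in> {z. Re z > 0}"
    then have z: "Re z > 0" "z \<noteq> 0" "z \<notin> \<real>\<^sub>\<le>\<^sub>0" 
      by (auto simp: complex_nonpos_Reals_iff)
    have adm: "bessel_admissible s 0 z" using z assms by (simp add: bessel_admissible_def)
    have "(h has_field_derivative of_real s * z powr (of_real s - 1) * bessel_integral s 0 z
            + - bessel_integral (s + 1) 0 z * z powr of_real s) (at z)"
      unfolding h_def
      by (intro DERIV_mult has_field_derivative_powr bessel_integral_deriv_a adm z)
    moreover have "z * bessel_integral (s + 1) 0 z = of_real s * bessel_integral s 0 z"
      using bessel_integral_recurrence[OF adm] by simp
    then have "bessel_integral (s + 1) 0 z = of_real s * bessel_integral s 0 z / z"
      using z by (simp add: field_simps)
    then have "of_real s * z powr (of_real s - 1) * bessel_integral s 0 z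
            + - bessel_integral (s + 1) 0 z * z powr of_real s = 0"
      using z by (simp add: powr_diff)
    ultimately show "(h has_field_derivative 0) (at z within {z. Re z > 0})"
      by (metis has_field_derivative_at_within)
  qed (rule convex_halfspace_Re_gt)
  then have "h a = h 1" using assms by force
  also have "\<dots> = of_real (Gamma s)" using assms by (simp add: h_def bessel_integral_0_1)
  finally have "a powr of_real s * bessel_integral s 0 a = of_real (Gamma s)" by (simp add: h_def)
  then show ?thesis using assms by (auto simp: powr_minus divide_simps mult_ac)
qed

text \<open>
  The substitution \<open>t = x / u\<close> exchanges the two parameters and negates the order. It reduces the
  behaviour at the origin for negative orders to that for positive orders.
\<close>

lemma bessel_integral_reflect:
  assumes "Re p > 0" "Re a > 0" "x > 0"
  shows "bessel_integral (- s) (of_real x * p) a = of_real (x powr (- s)) * bessel_integral s (of_real x * a) p"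
proof -
  define k1 where "k1 = bessel_kernel (- s) (of_real x * p) a"
  define k2 where "k2 = bessel_kernel s (of_real x * a) p"
  have i1: "set_integrable lborel {0<..} k1" and i2: "set_integrable lborel {0<..} k2"
    unfolding k1_def k2_def by (intro bessel_kernel_integrable, use assms in \<open>auto simp: bessel_admissible_def\<close>)+
  define g where "g = (\<lambda>u. x / u)"
  have g: "g ` {0<..} = {0<..}"
  proof (intro equalityI subsetI)
    fix y :: real assume "y \<in> {0<..}"
    then have "y = g (x / y)" "x / y \<in> {0<..}" using assms by (auto simp: g_def)
    then show "y \<in> g ` {0<..}" by blast
  qed (use assms in \<open>auto simp: g_def\<close>)
  have eq: "\<bar>- (x / u\<^sup>2)\<bar> *\<^sub>R k1 (g u) = of_real (x powr (- s)) * k2 u" if "u \<in> {0<..}" for u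
  proof -
    have u: "u > 0" using that by simp
    have "x / u\<^sup>2 * (x / u) powr (- s - 1) = x powr (- s) * u powr (s - 1)"
      using u assms(3)
      by (simp add: powr_divide powr_diff powr_minus power2_eq_square field_simps)
    then have "complex_of_real (x / u\<^sup>2 * (x / u) powr (- s - 1)) = of_real (x powr (- s) * u powr (s - 1))"
      by (rule arg_cong)
    moreover have "exp (- (of_real x * p / of_real (x / u)) - a * of_real (x / u)) = exp (- (of_real x * a / of_real u) - p * of_real u)"
      using u assms(3) by (intro arg_cong[where f = exp]) (simp add: field_simps)
    ultimately show ?thesis
      using u assms(3) unfolding k1_def k2_def bessel_kernel_def g_def scaleR_conv_of_real mult.assoc[symmetric]
      by (simp flip: of_real_mult)
  qed
  have k1: "k1 absolutely_integrable_on (g ` {0<..})"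
    using i1 unfolding g set_integrable_def by (rule integrable_completion[THEN iffD2, rotated])
      (use bessel_kernel_measurable in \<open>simp add: set_borel_measurable_def k1_def\<close>)
  have g_deriv: "(g has_field_derivative - (x / u\<^sup>2)) (at u within {0<..})" if "u \<in> {0<..}" for u
    unfolding g_def using that by (auto intro!: derivative_eq_intros simp: power2_eq_square)
  have g_inj: "inj_on g {0<..}" using assms(3) by (auto simp: g_def inj_on_def)
  have "integral {0<..} (\<lambda>u. \<bar>- (x / u\<^sup>2)\<bar> *\<^sub>R k1 (g u)) = integral (g ` {0<..}) k1"
    by (rule conjunct2[OF iffD2[OF has_absolute_integral_change_of_variables_real[OF _ g_deriv g_inj] conjI[OF k1 refl]]]) simp_all
  then have "integral {0<..} k1 = integral {0<..} (\<lambda>u. \<bar>- (x / u\<^sup>2)\<bar> *\<^sub>R k1 (g u))" by (simp add: g)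
  also have "\<dots> = integral {0<..} (\<lambda>u. of_real (x powr (- s)) * k2 u)"
    by (rule integral_cong) (rule eq)
  also have "\<dots> = of_real (x powr (- s)) * integral {0<..} k2" by simp
  finally show ?thesis
    using set_borel_integral_eq_integral(2)[OF i1] set_borel_integral_eq_integral(2)[OF i2]
    by (simp add: bessel_integral_def k1_def k2_def)
qed

lemma bessel_integral_tendsto_Gamma:
  assumes "s > 0" "Re p > 0" "Re a > 0"
  shows "((\<lambda>x. bessel_integral s (of_real x * p) a) \<longlongrightarrow> of_real (Gamma s) * a powr (- of_real s)) (at_right 0)"
proof -
  have "((\<lambda>x. bessel_integral s (of_real x * p) a) \<longlongrightarrow> bessel_integral s 0 a) (at_right 0)"
    unfolding bessel_integral_def
  proof (rule set_integral_dominated_convergence_at[where w = "\<lambda>t. t powr (s - 1) * exp (- Re a * t)"])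
    show "set_integrable lborel {0<..} (\<lambda>t. t powr (s - 1) * exp (- Re a * t))"
      using assms by (intro Gamma_kernel_integrable)
    fix x t :: real assume "x \<in> {0<..} - {0}" "t \<in> {0<..}"
    then show "norm (bessel_kernel s (of_real x * p) a t) \<le> t powr (s - 1) * exp (- Re a * t)"
      using assms by (simp add: norm_bessel_kernel)
  next
    fix t :: real assume "t \<in> {0<..}"
    have "((\<lambda>x. bessel_kernel s (of_real x * p) a t) \<longlongrightarrow> bessel_kernel s (of_real 0 * p) a t) (at_right 0)"
      unfolding bessel_kernel_def by (intro tendsto_intros) (use \<open>t \<in> {0<..}\<close> in auto)
    then show "((\<lambda>x. bessel_kernel s (of_real x * p) a t) \<longlongrightarrow> bessel_kernel s 0 a t) (at_right 0)" by simp
  qed (rule bessel_kernel_measurable)+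
  then show ?thesis using assms by (simp add: bessel_integral_0)
qed

text \<open>
  Near \<open>s\<close> the kernels are dominated by the sum of those of orders \<open>s - 1\<close> and \<open>s + 1\<close>.
\<close>

lemma bessel_integral_isCont_order:
  assumes "Re p > 0" "Re a > 0"
  shows "isCont (\<lambda>s. bessel_integral s p a) s"
proof -
  define w where "w = (\<lambda>t. norm (bessel_kernel (s + 1) p a t) + norm (bessel_kernel (s - 1) p a t))"
  have "((\<lambda>s. bessel_integral s p a) \<longlongrightarrow> bessel_integral s p a) (at s within {s - 1<..<s + 1})"
    unfolding bessel_integral_def
  proof (rule set_integral_dominated_convergence_at[where w = w])
    show "set_integrable lborel {0<..} w"
      unfolding w_def using assms
      by (intro set_integral_add set_integrable_norm bessel_kernel_integrable) (auto simp: bessel_admissible_def)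
    fix y t :: real assume y: "y \<in> {s - 1<..<s + 1} - {s}" and t: "t \<in> {0<..}"
    have "t powr (y - 1) \<le> t powr (s + 1 - 1) + t powr (s - 1 - 1)"
    proof (cases "t \<ge> 1")
      case True
      have "t powr (y - 1) \<le> t powr (s + 1 - 1)"
        using True y by (intro powr_mono) auto
      then show ?thesis by (simp add: add_increasing2)
    next
      case False
      have "t powr (y - 1) \<le> t powr (s - 1 - 1)"
        using False y t by (intro powr_mono') auto
      then show ?thesis by (simp add: add_increasing)
    qed
    then have "t powr (y - 1) * exp (- (Re p / t) - Re a * t) \<le>
        (t powr (s + 1 - 1) + t powr (s - 1 - 1)) * exp (- (Re p / t) - Re a * t)"
      by (intro mult_right_mono) auto
    then show "norm (bessel_kernel y p a t) \<le> w t"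
      using t by (simp add: w_def norm_bessel_kernel distrib_right)
  next
    fix t :: real assume "t \<in> {0<..}"
    then show "((\<lambda>s. bessel_kernel s p a t) \<longlongrightarrow> bessel_kernel s p a t) (at s within {s - 1<..<s + 1})"
      unfolding bessel_kernel_def by (intro tendsto_intros) auto
  qed (rule bessel_kernel_measurable)+
  then show ?thesis
    by (simp add: isCont_def at_within_open[of s "{s - 1<..<s + 1}"])
qed

section \<open>The power series of Bessel functions\<close>

text \<open>
  The Bessel--Clifford function, the entire factor of \<open>I\<^sub>\<alpha>\<close>: \<open>I\<^sub>\<alpha>(z) = (z/2)\<^bsup>\<alpha>\<^esup> A\<^sub>\<alpha>(z\<^bsup>2\<^esup>/4)\<close>. Separating it from
  the power \<open>(z/2)\<^bsup>\<alpha>\<^esup>\<close> confines all branches to powers of \<open>p\<close> and \<open>a\<close>.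
\<close>

definition bessel_clifford :: "real \<Rightarrow> complex \<Rightarrow> complex" where
  "bessel_clifford \<alpha> w = (\<Sum>n. of_real (rGamma (real n + \<alpha> + 1)) / fact n * w ^ n)"

lemma bessel_clifford_summable:
  "summable (\<lambda>n. of_real (rGamma (real n + \<alpha> + 1)) / fact n * w ^ n :: complex)"
proof (rule summable_ratio_test)
  \<comment> \<open>Beyond this index the Gamma argument is at least \<open>1\<close> and the ratio of terms at most \<open>1/2\<close>.\<close>
  define N where "N = nat \<lceil>2 * norm w + \<bar>\<alpha>\<bar> + 1\<rceil>"
  fix n assume "n \<ge> N"
  then have n: "real n \<ge> 2 * norm w + \<bar>\<alpha>\<bar> + 1" unfolding N_def by linarith
  define c where "c = real n + \<alpha> + 1"
  have c: "c \<ge> 1" using n norm_ge_zero[of w] unfolding c_def by linarith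
  have e1: "real (Suc n) + \<alpha> + 1 = c + 1" by (simp add: c_def)
  have r: "rGamma c = c * rGamma (c + 1)" by (simp add: rGamma_plus1)
  have "norm w / (real n + 1) \<le> 1 / 2" using n norm_ge_zero[of w] by (simp add: field_simps)
  also have "1 / 2 \<le> 1 / 2 * c" using c by simp
  finally have le: "norm w / (real n + 1) \<le> 1 / 2 * c" .
  have "norm (of_real (rGamma (real (Suc n) + \<alpha> + 1)) / fact (Suc n) * w ^ Suc n) =
     (\<bar>rGamma (c + 1)\<bar> / fact n * norm w ^ n) * (norm w / (real n + 1))"
    unfolding e1 fact_Suc norm_mult norm_divide norm_of_nat norm_fact norm_power by (simp add: field_simps)
  also have "\<dots> \<le> (\<bar>rGamma (c + 1)\<bar> / fact n * norm w ^ n) * (1 / 2 * c)"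
    by (rule mult_left_mono[OF le]) auto
  also have "\<dots> = 1 / 2 * norm (of_real (rGamma (real n + \<alpha> + 1)) / fact n * w ^ n)"
    using c unfolding c_def[symmetric] r by (simp add: norm_mult norm_divide norm_power abs_mult mult_ac)
  finally show "norm (of_real (rGamma (real (Suc n) + \<alpha> + 1)) / fact (Suc n) * w ^ Suc n) \<le> \<dots>" .
qed simp

lemma bessel_clifford_0: "bessel_clifford \<alpha> 0 = of_real (rGamma (\<alpha> + 1))"
  unfolding bessel_clifford_def using powser_zero[of "\<lambda>n. of_real (rGamma (real n + \<alpha> + 1)) / fact n :: complex"] by simp

lemma bessel_clifford_deriv:
  "(bessel_clifford \<alpha> has_field_derivative bessel_clifford (\<alpha> + 1) w) (at w)"
proof -
  have "(bessel_clifford \<alpha> has_field_derivative (\<Sum>n. diffs (\<lambda>n. of_real (rGamma (real n + \<alpha> + 1)) / fact n) n * w ^ n)) (at w)"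
    unfolding bessel_clifford_def[abs_def]
    by (rule termdiffs_strong_converges_everywhere) (rule bessel_clifford_summable)
  also have "diffs (\<lambda>n. of_real (rGamma (real n + \<alpha> + 1)) / fact n :: complex) = (\<lambda>n. of_real (rGamma (real n + (\<alpha> + 1) + 1)) / fact n)"
    using of_nat_neq_0[where ?'a = complex] by (intro ext) (simp add: diffs_def add_ac divide_simps)
  finally show ?thesis by (simp only: bessel_clifford_def[abs_def])
qed

lemma bessel_clifford_recurrence:
  "bessel_clifford \<alpha> w = w * bessel_clifford (\<alpha> + 2) w + of_real (\<alpha> + 1) * bessel_clifford (\<alpha> + 1) w"
proof -
  define c where "c = (\<lambda>\<alpha> n. of_real (rGamma (real n + \<alpha> + 1)) / fact n * w ^ n)"
  have s: "c \<alpha> sums bessel_clifford \<alpha> w" for \<alpha>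
    unfolding c_def bessel_clifford_def by (intro summable_sums bessel_clifford_summable)
  define d where "d = (\<lambda>n. c \<alpha> n - of_real (\<alpha> + 1) * c (\<alpha> + 1) n)"
  have d: "d n = of_nat n * c (\<alpha> + 1) n" for n
  proof -
    have "rGamma (real n + \<alpha> + 1) = (real n + \<alpha> + 1) * rGamma (real n + (\<alpha> + 1) + 1)"
      using rGamma_plus1[of "real n + \<alpha> + 1"] by (simp add: add_ac)
    then show ?thesis by (simp only: d_def c_def) (simp add: field_simps)
  qed
  have "d 0 = 0" "d (Suc n) = w * c (\<alpha> + 2) n" for n
    using of_nat_neq_0[where ?'a = complex, of n] by (simp_all add: d c_def add_ac divide_simps)
  then have "(\<lambda>n. d (Suc n)) sums (w * bessel_clifford (\<alpha> + 2) w)"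
    using sums_mult[OF s[of "\<alpha> + 2"], of w] by simp
  then have "d sums (w * bessel_clifford (\<alpha> + 2) w)"
    using \<open>d 0 = 0\<close> sums_Suc_iff[of d "w * bessel_clifford (\<alpha> + 2) w"] by simp
  moreover have "d sums (bessel_clifford \<alpha> w - of_real (\<alpha> + 1) * bessel_clifford (\<alpha> + 1) w)"
    unfolding d_def by (intro sums_diff sums_mult s)
  ultimately have "w * bessel_clifford (\<alpha> + 2) w = bessel_clifford \<alpha> w - of_real (\<alpha> + 1) * bessel_clifford (\<alpha> + 1) w"
    by (rule sums_unique2)
  then show ?thesis by (simp only: diff_add_cancel)
qed

section \<open>The connection formula for non-integer order\<close>

text \<open>
  The equation \<open>x f'' + (1 - \<alpha>) f' - a p f = 0\<close> for \<open>f\<close> along the ray \<open>x p\<close>, as a first-order system for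
  \<open>f0 = f\<close> and \<open>f1 = - f' / p\<close>. This choice of \<open>f1\<close> makes the second component of the integral solution
  the Bessel integral of order \<open>\<alpha> - 1\<close>.
\<close>

definition bessel_system :: "real \<Rightarrow> complex \<Rightarrow> complex \<Rightarrow> (real \<Rightarrow> complex) \<Rightarrow> (real \<Rightarrow> complex) \<Rightarrow> bool" where
  "bessel_system \<alpha> p a f0 f1 \<longleftrightarrow> (\<forall>x>0.
     (f0 has_vector_derivative - p * f1 x) (at x) \<and>
     (f1 has_vector_derivative (of_real (\<alpha> - 1) * f1 x - a * f0 x) / of_real x) (at x))"

text \<open>
  By the system, \<open>x W' = (\<alpha> - 1) W\<close> for the Wronskian \<open>W\<close>, so \<open>x\<^bsup>1-\<alpha>\<^esup> W\<close> is constant. Comparing the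
  value at \<open>1\<close> with the limit at the origin determines the Wronskian from leading-order behaviour
  alone.
\<close>

lemma bessel_system_wronskian:
  assumes f: "bessel_system \<alpha> p a f0 f1" and g: "bessel_system \<alpha> p a g0 g1"
    and l0: "(f0 \<longlongrightarrow> l0) (at_right 0)" and l1: "((\<lambda>x. of_real (x powr (1 - \<alpha>)) * f1 x) \<longlongrightarrow> l1) (at_right 0)"
    and m0: "(g0 \<longlongrightarrow> m0) (at_right 0)" and m1: "((\<lambda>x. of_real (x powr (1 - \<alpha>)) * g1 x) \<longlongrightarrow> m1) (at_right 0)"
  shows "f0 1 * g1 1 - f1 1 * g0 1 = l0 * m1 - l1 * m0"
proof -
  define W where "W = (\<lambda>x. of_real (x powr (1 - \<alpha>)) * (f0 x * g1 x - f1 x * g0 x))"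
  have "\<exists>c. \<forall>x\<in>{0<..}. W x = c"
  proof (rule has_vector_derivative_zero_constant)
    fix x :: real assume "x \<in> {0<..}"
    then have x: "x > 0" by simp
    note f' = f[unfolded bessel_system_def, rule_format, OF x] and g' = g[unfolded bessel_system_def, rule_format, OF x]
    have "((\<lambda>x. of_real (x powr (1 - \<alpha>)) :: complex) has_vector_derivative of_real ((1 - \<alpha>) * x powr (1 - \<alpha> - 1))) (at x)"
      using x by (intro has_vector_derivative_of_real has_real_derivative_powr)
    then have "(W has_vector_derivative of_real (x powr (1 - \<alpha>)) *
        ((f0 x * ((of_real (\<alpha> - 1) * g1 x - a * g0 x) / of_real x) + - p * f1 x * g1 x) -
         (f1 x * (- p * g1 x) + (of_real (\<alpha> - 1) * f1 x - a * f0 x) / of_real x * g0 x)) +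
        of_real ((1 - \<alpha>) * x powr (1 - \<alpha> - 1)) * (f0 x * g1 x - f1 x * g0 x)) (at x)" (is "(_ has_vector_derivative ?D) _")
      unfolding W_def using f' g'
      by (intro has_vector_derivative_mult has_vector_derivative_diff) auto
    moreover have "?D = 0"
    proof -
      have "x powr (1 - \<alpha> - 1) = x powr (1 - \<alpha>) / x"
        using x by (simp add: powr_diff powr_minus_divide)
      then show ?thesis
        using x by (simp only: of_real_mult of_real_divide) (simp add: divide_simps, simp add: algebra_simps)
    qed
    ultimately show "(W has_vector_derivative 0) (at x within {0<..})"
      by (metis has_vector_derivative_at_within)
  qed (simp, blast)
  then obtain c where c: "W x = c" if "x > 0" for x by auto
  have "((\<lambda>x. f0 x * (of_real (x powr (1 - \<alpha>)) * g1 x) - (of_real (x powr (1 - \<alpha>)) * f1 x) * g0 x) \<longlongrightarrow> l0 * m1 - l1 * m0) (at_right 0)"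
    by (intro tendsto_intros l0 l1 m0 m1)
  then have "(W \<longlongrightarrow> l0 * m1 - l1 * m0) (at_right 0)"
    by (simp add: W_def algebra_simps)
  moreover have "(W \<longlongrightarrow> c) (at_right 0)"
    by (rule tendsto_eventually) (auto simp: eventually_at_filter c)
  ultimately have "c = l0 * m1 - l1 * m0"
    using tendsto_unique trivial_limit_at_right_real by blast
  with c[of 1] show ?thesis by (simp add: W_def)
qed

lemma bessel_system_integral:
  assumes "Re p > 0" "Re a > 0"
  shows "bessel_system \<alpha> p a (\<lambda>x. bessel_integral \<alpha> (of_real x * p) a) (\<lambda>x. bessel_integral (\<alpha> - 1) (of_real x * p) a)"
  unfolding bessel_system_def
proof (intro allI impI)
  fix x :: real assume x: "x > 0"
  have xp: "Re (of_real x * p) > 0" using x assms by simp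
  have d: "((\<lambda>x. bessel_integral s (of_real x * p) a) has_vector_derivative - p * bessel_integral (s - 1) (of_real x * p) a) (at x)" for s
  proof -
    have "((\<lambda>z. bessel_integral s (z * p) a) has_field_derivative - bessel_integral (s - 1) (of_real x * p) a * p) (at (of_real x))"
      using xp assms
      by (intro DERIV_chain2[where g = "\<lambda>z. z * p" and f = "\<lambda>z. bessel_integral s z a"] bessel_integral_deriv_p)
        (auto intro!: derivative_eq_intros)
    then show ?thesis by (auto dest: has_vector_derivative_real_field simp: mult.commute)
  qed
  have "bessel_admissible (\<alpha> - 1) (of_real x * p) a"
    using xp assms by (simp add: bessel_admissible_def)
  from bessel_integral_recurrence[OF this]
  have "- p * bessel_integral (\<alpha> - 1 - 1) (of_real x * p) a =
     (of_real (\<alpha> - 1) * bessel_integral (\<alpha> - 1) (of_real x * p) a - a * bessel_integral \<alpha> (of_real x * p) a) / of_real x"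
    using x by (simp add: field_simps)
  then show "((\<lambda>x. bessel_integral \<alpha> (of_real x * p) a) has_vector_derivative - p * bessel_integral (\<alpha> - 1) (of_real x * p) a) (at x) \<and>
    ((\<lambda>x. bessel_integral (\<alpha> - 1) (of_real x * p) a) has_vector_derivative
     (of_real (\<alpha> - 1) * bessel_integral (\<alpha> - 1) (of_real x * p) a - a * bessel_integral \<alpha> (of_real x * p) a) / of_real x) (at x)"
    using d[of \<alpha>] d[of "\<alpha> - 1"] by simp
qed

lemma bessel_clifford_ray_deriv:
  "((\<lambda>x. bessel_clifford \<alpha> (of_real x * w)) has_vector_derivative w * bessel_clifford (\<alpha> + 1) (of_real x * w)) (at x)"
proof -
  have "((\<lambda>z. bessel_clifford \<alpha> (z * w)) has_field_derivative bessel_clifford (\<alpha> + 1) (of_real x * w) * w) (at (of_real x))"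
    by (intro DERIV_chain2[where g = "\<lambda>z. z * w" and f = "bessel_clifford \<alpha>"] bessel_clifford_deriv)
      (auto intro!: derivative_eq_intros)
  then show ?thesis by (auto dest: has_vector_derivative_real_field simp: mult.commute)
qed

lemma bessel_clifford_ray_tendsto:
  "((\<lambda>x. bessel_clifford \<alpha> (of_real x * w)) \<longlongrightarrow> of_real (rGamma (\<alpha> + 1))) (at_right 0)"
proof -
  have "((\<lambda>x. bessel_clifford \<alpha> (of_real x * w)) \<longlongrightarrow> bessel_clifford \<alpha> (of_real 0 * w)) (at_right 0)"
    using has_vector_derivative_continuous[OF bessel_clifford_ray_deriv[of \<alpha> w 0]]
    by (simp only: isCont_def) (rule tendsto_within_subset, auto)
  then show ?thesis by (simp add: bessel_clifford_0)
qed

text \<open>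
  The Frobenius solution with exponent \<open>0\<close> at the origin.
\<close>

lemma bessel_system_clifford_regular:
  assumes "a \<noteq> 0"
  shows "bessel_system \<alpha> p a (\<lambda>x. a powr (- of_real \<alpha>) * bessel_clifford (- \<alpha>) (of_real x * (a * p)))
           (\<lambda>x. - (a powr (1 - of_real \<alpha>) * bessel_clifford (1 - \<alpha>) (of_real x * (a * p))))"
  unfolding bessel_system_def
proof (intro allI impI conjI)
  fix x :: real assume x: "x > 0"
  have a: "a powr (1 - of_real \<alpha>) = a * a powr (- of_real \<alpha>)"
    using assms by (simp add: powr_diff powr_minus divide_inverse)
  show "((\<lambda>x. a powr (- of_real \<alpha>) * bessel_clifford (- \<alpha>) (of_real x * (a * p))) has_vector_derivative
     - p * - (a powr (1 - of_real \<alpha>) * bessel_clifford (1 - \<alpha>) (of_real x * (a * p)))) (at x)"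
    using has_vector_derivative_mult_right[OF bessel_clifford_ray_deriv[of "- \<alpha>" "a * p" x], of "a powr (- of_real \<alpha>)"]
    by (simp add: a mult_ac)
  have "bessel_clifford (- \<alpha>) (of_real x * (a * p)) = of_real x * (a * p) * bessel_clifford (2 - \<alpha>) (of_real x * (a * p))
      + of_real (1 - \<alpha>) * bessel_clifford (1 - \<alpha>) (of_real x * (a * p))"
    using bessel_clifford_recurrence[of "- \<alpha>"] by simp
  then have "(of_real (\<alpha> - 1) * - (a powr (1 - of_real \<alpha>) * bessel_clifford (1 - \<alpha>) (of_real x * (a * p)))
     - a * (a powr (- of_real \<alpha>) * bessel_clifford (- \<alpha>) (of_real x * (a * p)))) / of_real x =
     - (a powr (1 - of_real \<alpha>) * ((a * p) * bessel_clifford (2 - \<alpha>) (of_real x * (a * p))))"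
    using x unfolding a by (simp add: divide_simps) (simp add: algebra_simps)
  then show "((\<lambda>x. - (a powr (1 - of_real \<alpha>) * bessel_clifford (1 - \<alpha>) (of_real x * (a * p)))) has_vector_derivative
     (of_real (\<alpha> - 1) * - (a powr (1 - of_real \<alpha>) * bessel_clifford (1 - \<alpha>) (of_real x * (a * p)))
     - a * (a powr (- of_real \<alpha>) * bessel_clifford (- \<alpha>) (of_real x * (a * p)))) / of_real x) (at x)"
    using has_vector_derivative_minus[OF has_vector_derivative_mult_right[OF bessel_clifford_ray_deriv[of "1 - \<alpha>" "a * p" x], of "a powr (1 - of_real \<alpha>)"]]
    by (simp add: mult_ac)
qed

text \<open>
  The Frobenius solution with exponent \<open>\<alpha>\<close> at the origin. Writing \<open>(x p)\<^bsup>\<alpha>\<^esup>\<close> as \<open>x\<^bsup>\<alpha>\<^esup> p\<^bsup>\<alpha>\<^esup>\<close> keeps the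
  differentiated power real.
\<close>

lemma bessel_system_clifford_branch:
  assumes "p \<noteq> 0"
  shows "bessel_system \<alpha> p a (\<lambda>x. of_real (x powr \<alpha>) * (p powr of_real \<alpha> * bessel_clifford \<alpha> (of_real x * (a * p))))
           (\<lambda>x. - (of_real (x powr (\<alpha> - 1)) * (p powr of_real (\<alpha> - 1) * bessel_clifford (\<alpha> - 1) (of_real x * (a * p)))))"
  unfolding bessel_system_def
proof (intro allI impI conjI)
  fix x :: real assume x: "x > 0"
  define w where "w = of_real x * (a * p)"
  have d: "((\<lambda>x. of_real (x powr s) * (c * bessel_clifford \<beta> (of_real x * (a * p)))) has_vector_derivative
      of_real (x powr s) * (c * (a * p * bessel_clifford (\<beta> + 1) w)) + of_real (s * x powr (s - 1)) * (c * bessel_clifford \<beta> w)) (at x)" for s c \<beta>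
    unfolding w_def using x
    by (intro has_vector_derivative_mult has_vector_derivative_of_real has_real_derivative_powr
         has_vector_derivative_mult_right bessel_clifford_ray_deriv)
  have p: "p powr of_real \<alpha> = p * p powr of_real (\<alpha> - 1)"
    using assms by (simp add: powr_diff)
  have xx: "x powr \<alpha> = x * x powr (\<alpha> - 1)" "x powr (\<alpha> - 1 - 1) = x powr (\<alpha> - 1) / x"
    using x by (simp_all add: powr_diff power2_eq_square)
  have rec: "bessel_clifford (\<alpha> - 1) w = w * bessel_clifford (\<alpha> + 1) w + of_real \<alpha> * bessel_clifford \<alpha> w"
    using bessel_clifford_recurrence[of "\<alpha> - 1" w] by (simp add: add_ac)
  have e: "of_real (x powr \<alpha>) * (p powr of_real \<alpha> * (a * p * bessel_clifford (\<alpha> + 1) w)) + of_real (\<alpha> * x powr (\<alpha> - 1)) * (p powr of_real \<alpha> * bessel_clifford \<alpha> w)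
     = - p * - (of_real (x powr (\<alpha> - 1)) * (p powr of_real (\<alpha> - 1) * bessel_clifford (\<alpha> - 1) w))"
    unfolding rec p xx by (simp add: w_def algebra_simps)
  show "((\<lambda>x. of_real (x powr \<alpha>) * (p powr of_real \<alpha> * bessel_clifford \<alpha> (of_real x * (a * p)))) has_vector_derivative
    - p * - (of_real (x powr (\<alpha> - 1)) * (p powr of_real (\<alpha> - 1) * bessel_clifford (\<alpha> - 1) (of_real x * (a * p))))) (at x)"
    using d[of \<alpha> "p powr of_real \<alpha>" \<alpha>] unfolding e unfolding w_def .
  have e': "- (of_real (x powr (\<alpha> - 1)) * (p powr of_real (\<alpha> - 1) * (a * p * bessel_clifford (\<alpha> - 1 + 1) w)) +
       of_real ((\<alpha> - 1) * x powr (\<alpha> - 1 - 1)) * (p powr of_real (\<alpha> - 1) * bessel_clifford (\<alpha> - 1) w))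
     = (of_real (\<alpha> - 1) * - (of_real (x powr (\<alpha> - 1)) * (p powr of_real (\<alpha> - 1) * bessel_clifford (\<alpha> - 1) w))
        - a * (of_real (x powr \<alpha>) * (p powr of_real \<alpha> * bessel_clifford \<alpha> w))) / of_real x"
    using x unfolding xx p by (simp add: field_simps)
  show "((\<lambda>x. - (of_real (x powr (\<alpha> - 1)) * (p powr of_real (\<alpha> - 1) * bessel_clifford (\<alpha> - 1) (of_real x * (a * p))))) has_vector_derivative
    (of_real (\<alpha> - 1) * - (of_real (x powr (\<alpha> - 1)) * (p powr of_real (\<alpha> - 1) * bessel_clifford (\<alpha> - 1) (of_real x * (a * p))))
        - a * (of_real (x powr \<alpha>) * (p powr of_real \<alpha> * bessel_clifford \<alpha> (of_real x * (a * p))))) / of_real x) (at x)"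
    using has_vector_derivative_minus[OF d[of "\<alpha> - 1" "p powr of_real (\<alpha> - 1)" "\<alpha> - 1"]] unfolding e' unfolding w_def .
qed

text \<open>
  This is \<open>(p/a)\<^bsup>\<alpha>/2\<^esup> (I\<^bsub>-\<alpha>\<^esub>(z) - I\<^sub>\<alpha>(z))\<close> at \<open>z = 2 \<surd>(pa)\<close>, written without half powers.
\<close>

definition bessel_branch_difference :: "real \<Rightarrow> complex \<Rightarrow> complex \<Rightarrow> complex" where
  "bessel_branch_difference \<alpha> p a =
     a powr (- of_real \<alpha>) * bessel_clifford (- \<alpha>) (a * p) - p powr of_real \<alpha> * bessel_clifford \<alpha> (a * p)"

text \<open>
  The system is two-dimensional, so the integral pair \<open>Y\<close> is a combination of the Frobenius pairs \<open>U\<close>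
  and \<open>V\<close> with ratios of Wronskians as coefficients. The restriction \<open>0 < \<alpha> < 1\<close> is what makes the
  leading terms at the origin visible: \<open>Y0\<close> tends to \<open>\<Gamma>(\<alpha>) a\<^bsup>-\<alpha>\<^esup>\<close> and, after reflection,
  \<open>x\<^bsup>1-\<alpha>\<^esup> Y1\<close> tends to \<open>\<Gamma>(1 - \<alpha>) p\<^bsup>\<alpha>-1\<^esup>\<close>. Euler's reflection formula evaluates the Wronskian of
  \<open>U\<close> and \<open>V\<close>. The second component gives the formula for order \<open>\<alpha> - 1\<close>, which starts the recurrence.
\<close>

lemma bessel_connection_unit:
  assumes "Re p > 0" "Re a > 0" "0 < \<alpha>" "\<alpha> < 1"
  shows "of_real (sin (\<alpha> * pi)) * bessel_integral \<alpha> p a = of_real pi * bessel_branch_difference \<alpha> p a"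
    and "of_real (sin ((\<alpha> - 1) * pi)) * bessel_integral (\<alpha> - 1) p a = of_real pi * bessel_branch_difference (\<alpha> - 1) p a"
proof -
  have nz: "p \<noteq> 0" "a \<noteq> 0" using assms by auto
  define P where "P = p powr of_real (\<alpha> - 1)"
  define A where "A = a powr (- of_real \<alpha>)"
  define Y0 where "Y0 = (\<lambda>x. bessel_integral \<alpha> (of_real x * p) a)"
  define Y1 where "Y1 = (\<lambda>x. bessel_integral (\<alpha> - 1) (of_real x * p) a)"
  define U0 where "U0 = (\<lambda>x. A * bessel_clifford (- \<alpha>) (of_real x * (a * p)))"
  define U1 where "U1 = (\<lambda>x. - (a powr (1 - of_real \<alpha>) * bessel_clifford (1 - \<alpha>) (of_real x * (a * p))))"
  define V0 where "V0 = (\<lambda>x. of_real (x powr \<alpha>) * (p powr of_real \<alpha> * bessel_clifford \<alpha> (of_real x * (a * p))))"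
  define V1 where "V1 = (\<lambda>x. - (of_real (x powr (\<alpha> - 1)) * (P * bessel_clifford (\<alpha> - 1) (of_real x * (a * p)))))"
  have Y: "bessel_system \<alpha> p a Y0 Y1" unfolding Y0_def Y1_def by (rule bessel_system_integral) fact+
  have U: "bessel_system \<alpha> p a U0 U1" unfolding U0_def U1_def A_def by (rule bessel_system_clifford_regular) fact
  have V: "bessel_system \<alpha> p a V0 V1" unfolding V0_def V1_def P_def by (rule bessel_system_clifford_branch) fact
  have pos: "\<forall>\<^sub>F x in at_right 0. x > (0::real)" by (simp add: eventually_at_filter)
  have pow0: "((\<lambda>x. of_real (x powr s) :: complex) \<longlongrightarrow> 0) (at_right 0)" if "s > 0" for s :: real
    using that by (intro tendsto_of_real_iff[THEN iffD2, of _ 0, simplified]) real_asymp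
  have Y0: "(Y0 \<longlongrightarrow> of_real (Gamma \<alpha>) * A) (at_right 0)"
    unfolding Y0_def A_def using assms by (intro bessel_integral_tendsto_Gamma)
  have Y1: "((\<lambda>x. of_real (x powr (1 - \<alpha>)) * Y1 x) \<longlongrightarrow> of_real (Gamma (1 - \<alpha>)) * P) (at_right 0)"
  proof -
    have "((\<lambda>x. bessel_integral (1 - \<alpha>) (of_real x * a) p) \<longlongrightarrow> of_real (Gamma (1 - \<alpha>)) * P) (at_right 0)"
      using bessel_integral_tendsto_Gamma[of "1 - \<alpha>" a p] assms by (simp add: P_def)
    moreover have "of_real (x powr (1 - \<alpha>)) * Y1 x = bessel_integral (1 - \<alpha>) (of_real x * a) p" if "x > 0" for x
      using bessel_integral_reflect[of p a x "1 - \<alpha>"] assms that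
      by (simp add: Y1_def mult.assoc[symmetric] flip: powr_add of_real_mult)
    ultimately show ?thesis
      by (subst tendsto_cong[OF eventually_mono[OF pos]])
  qed
  have U0: "(U0 \<longlongrightarrow> A * of_real (rGamma (1 - \<alpha>))) (at_right 0)"
    using bessel_clifford_ray_tendsto[of "- \<alpha>"] unfolding U0_def by (intro tendsto_intros) simp
  have U1: "((\<lambda>x. of_real (x powr (1 - \<alpha>)) * U1 x) \<longlongrightarrow> 0) (at_right 0)"
    unfolding U1_def
    using tendsto_mult[OF pow0[of "1 - \<alpha>"] tendsto_minus[OF tendsto_mult[OF tendsto_const[of "a powr (1 - of_real \<alpha>)"] bessel_clifford_ray_tendsto[of "1 - \<alpha>" "a * p"]]]] assms
    by simp
  have V0: "(V0 \<longlongrightarrow> 0) (at_right 0)"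
    unfolding V0_def
    using tendsto_mult[OF pow0[of \<alpha>] tendsto_mult[OF tendsto_const[of "p powr of_real \<alpha>"] bessel_clifford_ray_tendsto[of \<alpha> "a * p"]]] assms
    by simp
  have V1: "((\<lambda>x. of_real (x powr (1 - \<alpha>)) * V1 x) \<longlongrightarrow> - (P * of_real (rGamma \<alpha>))) (at_right 0)"
  proof -
    have "((\<lambda>x. - (P * bessel_clifford (\<alpha> - 1) (of_real x * (a * p)))) \<longlongrightarrow> - (P * of_real (rGamma \<alpha>))) (at_right 0)"
      using bessel_clifford_ray_tendsto[of "\<alpha> - 1"] by (intro tendsto_intros) simp
    moreover have "of_real (x powr (1 - \<alpha>)) * V1 x = - (P * bessel_clifford (\<alpha> - 1) (of_real x * (a * p)))" if "x > 0" for x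
      using that by (simp add: V1_def mult.assoc[symmetric] flip: powr_add of_real_mult)
    ultimately show ?thesis
      by (subst tendsto_cong[OF eventually_mono[OF pos]])
  qed
  have gg: "rGamma \<alpha> * Gamma \<alpha> = 1" "rGamma (1 - \<alpha>) * Gamma (1 - \<alpha>) = 1"
    using Gamma_real_pos[OF \<open>0 < \<alpha>\<close>] Gamma_real_pos[of "1 - \<alpha>", unfolded diff_gt_0_iff_gt, OF \<open>\<alpha> < 1\<close>]
    unfolding rGamma_inverse_Gamma by (intro left_inverse; linarith)+
  have refl: "rGamma \<alpha> * rGamma (1 - \<alpha>) * pi = sin (\<alpha> * pi)"
  proof -
    have "complex_of_real (rGamma \<alpha> * rGamma (1 - \<alpha>)) = of_real (sin (pi * \<alpha>) / pi)"
      using rGamma_reflection_complex[of "of_real \<alpha>"] rGamma_complex_of_real[of "1 - \<alpha>"]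
      by (simp add: rGamma_complex_of_real sin_of_real flip: of_real_mult)
    then show ?thesis by (simp only: of_real_eq_iff) (simp add: mult.commute)
  qed
  \<comment> \<open>The three limits give the Wronskians, in which the Gamma factors cancel or combine to the sine.\<close>
  have YV: "Y0 1 * V1 1 - Y1 1 * V0 1 = - (A * P)"
    using bessel_system_wronskian[OF Y V Y0 Y1 V0 V1] gg(1)
    by (simp add: algebra_simps flip: of_real_mult)
  have YU: "Y0 1 * U1 1 - Y1 1 * U0 1 = - (A * P)"
    using bessel_system_wronskian[OF Y U Y0 Y1 U0 U1] gg(2)
    by (simp add: algebra_simps flip: of_real_mult)
  have UV: "of_real pi * (U0 1 * V1 1 - U1 1 * V0 1) = - (A * P) * of_real (sin (\<alpha> * pi))"
    using bessel_system_wronskian[OF U V U0 U1 V0 V1]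
    by (simp add: refl[symmetric])
  have AP: "A * P \<noteq> 0" using nz by (simp add: A_def P_def)
  \<comment> \<open>Cramer's rule: \<open>Y0 W(U,V) = U0 W(Y,V) - V0 W(Y,U)\<close>, and likewise for \<open>Y1\<close>.\<close>
  have "(A * P) * (of_real (sin (\<alpha> * pi)) * Y0 1) = (A * P) * (of_real pi * (U0 1 - V0 1))"
    using YV YU UV by algebra
  then have "of_real (sin (\<alpha> * pi)) * Y0 1 = of_real pi * (U0 1 - V0 1)"
    using AP by (simp only: mult_cancel_left simp_thms)
  then show "of_real (sin (\<alpha> * pi)) * bessel_integral \<alpha> p a = of_real pi * bessel_branch_difference \<alpha> p a"
    by (simp add: Y0_def U0_def V0_def A_def bessel_branch_difference_def)
  have "(A * P) * (of_real (sin (\<alpha> * pi)) * Y1 1) = (A * P) * (of_real pi * (U1 1 - V1 1))"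
    using YV YU UV by algebra
  then have "of_real (sin (\<alpha> * pi)) * Y1 1 = of_real pi * (U1 1 - V1 1)"
    using AP by (simp only: mult_cancel_left simp_thms)
  moreover have "sin ((\<alpha> - 1) * pi) = - sin (\<alpha> * pi)" by (simp add: left_diff_distrib)
  ultimately show "of_real (sin ((\<alpha> - 1) * pi)) * bessel_integral (\<alpha> - 1) p a = of_real pi * bessel_branch_difference (\<alpha> - 1) p a"
    by (simp add: Y1_def U1_def V1_def P_def bessel_branch_difference_def algebra_simps)
qed

text \<open>
  Both sides satisfy the same three-term recurrence in the order, the signs of \<open>sin (\<pi>\<alpha>)\<close> included.
\<close>

lemma bessel_connection_step:
  assumes "Re p > 0" "Re a > 0"
    and "of_real (sin (\<alpha> * pi)) * bessel_integral \<alpha> p a = of_real pi * bessel_branch_difference \<alpha> p a"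
    and "of_real (sin ((\<alpha> - 1) * pi)) * bessel_integral (\<alpha> - 1) p a = of_real pi * bessel_branch_difference (\<alpha> - 1) p a"
  shows "of_real (sin ((\<alpha> + 1) * pi)) * bessel_integral (\<alpha> + 1) p a = of_real pi * bessel_branch_difference (\<alpha> + 1) p a"
proof -
  have nz: "p \<noteq> 0" "a \<noteq> 0" using assms by auto
  have s: "sin ((\<alpha> - 1) * pi) = - sin (\<alpha> * pi)" "sin ((\<alpha> + 1) * pi) = - sin (\<alpha> * pi)"
    by (simp_all add: left_diff_distrib distrib_right)
  define A where "A = a powr (- of_real \<alpha>)"
  define P where "P = p powr of_real \<alpha>"
  define B where "B = (\<lambda>\<beta>. bessel_clifford \<beta> (a * p))"
  have b: "bessel_branch_difference \<alpha> p a = A * B (- \<alpha>) - P * B \<alpha>"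
    "p * bessel_branch_difference (\<alpha> - 1) p a = p * a * A * B (1 - \<alpha>) - P * B (\<alpha> - 1)"
    "a * bessel_branch_difference (\<alpha> + 1) p a = A * B (- 1 - \<alpha>) - a * p * P * B (\<alpha> + 1)"
    using nz by (simp_all add: bessel_branch_difference_def A_def P_def B_def powr_diff powr_add powr_minus field_simps)
  have r1: "B (\<alpha> - 1) = a * p * B (\<alpha> + 1) + of_real \<alpha> * B \<alpha>"
    using bessel_clifford_recurrence[of "\<alpha> - 1" "a * p"] by (simp add: B_def add_ac)
  have r2: "B (- 1 - \<alpha>) = a * p * B (1 - \<alpha>) - of_real \<alpha> * B (- \<alpha>)"
    using bessel_clifford_recurrence[of "- 1 - \<alpha>" "a * p"] by (simp add: B_def)
  have "a * bessel_integral (\<alpha> + 1) p a = of_real \<alpha> * bessel_integral \<alpha> p a + p * bessel_integral (\<alpha> - 1) p a"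
    using assms by (intro bessel_integral_recurrence) (simp add: bessel_admissible_def)
  then have "a * (of_real (sin ((\<alpha> + 1) * pi)) * bessel_integral (\<alpha> + 1) p a) =
      - of_real \<alpha> * (of_real (sin (\<alpha> * pi)) * bessel_integral \<alpha> p a) + p * (of_real (sin ((\<alpha> - 1) * pi)) * bessel_integral (\<alpha> - 1) p a)"
    unfolding s of_real_minus by algebra
  also have "\<dots> = of_real pi * (- of_real \<alpha> * bessel_branch_difference \<alpha> p a + p * bessel_branch_difference (\<alpha> - 1) p a)"
    unfolding assms(3,4) by (simp add: algebra_simps)
  also have "\<dots> = of_real pi * (a * bessel_branch_difference (\<alpha> + 1) p a)"
    unfolding b r1 r2 by (simp add: algebra_simps)
  finally show ?thesis using nz by simp
qed

lemma bessel_connection: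
  assumes "Re p > 0" "Re a > 0" "\<alpha> \<in> {0<..<3}" "\<alpha> \<notin> {1, 2}"
  shows "of_real (sin (\<alpha> * pi)) * bessel_integral \<alpha> p a = of_real pi * bessel_branch_difference \<alpha> p a"
proof -
  have 1: "of_real (sin (\<alpha> * pi)) * bessel_integral \<alpha> p a = of_real pi * bessel_branch_difference \<alpha> p a"
    if "0 < \<alpha>" "\<alpha> < 1" for \<alpha> using bessel_connection_unit[OF assms(1,2) that] by blast
  have 2: "of_real (sin (\<alpha> * pi)) * bessel_integral \<alpha> p a = of_real pi * bessel_branch_difference \<alpha> p a"
    if "1 < \<alpha>" "\<alpha> < 2" for \<alpha>
    using bessel_connection_step[OF assms(1,2) bessel_connection_unit[OF assms(1,2), of "\<alpha> - 1"]] that by simp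
  have 3: "of_real (sin (\<alpha> * pi)) * bessel_integral \<alpha> p a = of_real pi * bessel_branch_difference \<alpha> p a"
    if "2 < \<alpha>" "\<alpha> < 3" for \<alpha>
    using bessel_connection_step[OF assms(1,2) 2[of "\<alpha> - 1"]] 1[of "\<alpha> - 2"] that by simp
  show ?thesis using 1[of \<alpha>] 2[of \<alpha>] 3[of \<alpha>] assms(3,4) by fastforce
qed

section \<open>Bessel functions of the second kind of orders 1 and 2\<close>

text \<open>
  The branches agree because the arguments of \<open>p\<close> and \<open>a\<close> lie strictly between \<open>-\<pi>/2\<close> and \<open>\<pi>/2\<close>, so the
  mean \<open>(Ln p + Ln a) / 2\<close> is the principal logarithm of \<open>csqrt (p * a)\<close>.
\<close>

lemma csqrt_mult_powr:
  assumes "Re p > 0" "Re a > 0"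
  shows "csqrt (p * a) powr of_real \<beta> = p powr of_real (\<beta> / 2) * a powr of_real (\<beta> / 2)"
proof -
  define w where "w = (Ln p + Ln a) / 2"
  have nz: "p \<noteq> 0" "a \<noteq> 0" using assms by auto
  have "\<bar>Im (Ln p)\<bar> < pi / 2" "\<bar>Im (Ln a)\<bar> < pi / 2"
    using assms nz Re_Ln_pos_lt by blast+
  then have w: "\<bar>Im w\<bar> < pi / 2" by (simp add: w_def)
  have "csqrt (p * a) = exp w"
  proof (rule csqrt_unique)
    show "(exp w)\<^sup>2 = p * a"
    proof -
      have "2 * w = Ln p + Ln a" by (simp add: w_def)
      then show ?thesis using nz by (simp only: exp_double[symmetric] exp_add) simp
    qed
    show "Re (exp w) > 0 \<or> Re (exp w) = 0 \<and> 0 \<le> Im (exp w)"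
      using w by (simp add: Re_exp cos_gt_zero_pi abs_less_iff)
  qed
  then have "Ln (csqrt (p * a)) = w"
    using w pi_gt_zero by (auto simp: abs_less_iff intro!: Ln_exp)
  moreover have "of_real \<beta> * w = of_real (\<beta> / 2) * Ln p + of_real (\<beta> / 2) * Ln a"
    by (simp add: w_def field_simps)
  ultimately show ?thesis using nz by (simp add: powr_def exp_add)
qed

lemma bessel_I_csqrt:
  assumes "Re p > 0" "Re a > 0"
  shows "bessel_I \<nu> (2 * csqrt (p * a)) = p powr of_real (\<nu> / 2) * a powr of_real (\<nu> / 2) * bessel_clifford \<nu> (a * p)"
  using csqrt_mult_powr[OF assms, of \<nu>]
  by (simp add: bessel_I_def bessel_clifford_def power_mult mult.commute[of a p])

lemma bessel_K_quotient:
  assumes "Re p > 0" "Re a > 0" "\<alpha> \<in> {0<..<3}" "\<alpha> \<notin> {1, 2}"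
  shows "of_real pi / 2 * (bessel_I (- \<alpha>) (2 * csqrt (p * a)) - bessel_I \<alpha> (2 * csqrt (p * a))) / of_real (sin (\<alpha> * pi))
     = p powr of_real (- \<alpha> / 2) * a powr of_real (\<alpha> / 2) * bessel_integral \<alpha> p a / 2"
proof -
  have nz: "p \<noteq> 0" "a \<noteq> 0" using assms by auto
  have "\<alpha> \<notin> \<int>"
  proof
    assume "\<alpha> \<in> \<int>"
    then obtain n :: int where "\<alpha> = of_int n" by (rule Ints_cases)
    with assms(3,4) show False by auto
  qed
  then have s: "sin (\<alpha> * pi) \<noteq> 0" by (simp add: sin_times_pi_eq_0)
  have p: "p powr of_real (\<alpha> / 2) = p powr of_real (- \<alpha> / 2) * p powr of_real \<alpha>"
    unfolding powr_add[symmetric] by (rule arg_cong[where f = "\<lambda>x. p powr x"]) (simp add: field_simps)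
  have a: "a powr of_real (- \<alpha> / 2) = a powr of_real (\<alpha> / 2) * a powr (- of_real \<alpha>)"
    unfolding powr_add[symmetric] by (rule arg_cong[where f = "\<lambda>x. a powr x"]) (simp add: field_simps)
  have "bessel_I (- \<alpha>) (2 * csqrt (p * a)) - bessel_I \<alpha> (2 * csqrt (p * a)) =
      p powr of_real (- \<alpha> / 2) * a powr of_real (\<alpha> / 2) * bessel_branch_difference \<alpha> p a"
    unfolding bessel_I_csqrt[OF assms(1,2)] bessel_branch_difference_def p a by (simp add: algebra_simps)
  then have "of_real pi / 2 * (bessel_I (- \<alpha>) (2 * csqrt (p * a)) - bessel_I \<alpha> (2 * csqrt (p * a))) =
      p powr of_real (- \<alpha> / 2) * a powr of_real (\<alpha> / 2) / 2 * (of_real pi * bessel_branch_difference \<alpha> p a)"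
    by simp
  also have "\<dots> = p powr of_real (- \<alpha> / 2) * a powr of_real (\<alpha> / 2) / 2 * (of_real (sin (\<alpha> * pi)) * bessel_integral \<alpha> p a)"
    by (simp only: bessel_connection[OF assms])
  finally show ?thesis using s by simp
qed

text \<open>
  By the connection formula, the quotient whose limit defines \<open>K\<^sub>n\<close> equals a function continuous in the
  order on a punctured neighbourhood of \<open>n\<close>.
\<close>

lemma bessel_K_integral:
  assumes "Re p > 0" "Re a > 0" "n \<in> {1, 2}"
  shows "bessel_K n (2 * csqrt (p * a)) = p powr of_real (- n / 2) * a powr of_real (n / 2) * bessel_integral n p a / 2"
proof -
  have nz: "p \<noteq> 0" "a \<noteq> 0" using assms by auto
  define q where "q = (\<lambda>\<alpha>::real. of_real pi / 2 * (bessel_I (- \<alpha>) (2 * csqrt (p * a)) - bessel_I \<alpha> (2 * csqrt (p * a))) / of_real (sin (\<alpha> * pi)))"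
  have pw: "((\<lambda>\<alpha>. z powr of_real (h \<alpha>)) \<longlongrightarrow> z powr of_real h0) (at n)" if "(h \<longlongrightarrow> h0) (at n)" "z \<noteq> 0" for h h0 and z :: complex
    using that by (auto simp: powr_def intro!: tendsto_intros)
  have "((\<lambda>\<alpha>. p powr of_real (- \<alpha> / 2) * a powr of_real (\<alpha> / 2) * bessel_integral \<alpha> p a / 2)
     \<longlongrightarrow> p powr of_real (- n / 2) * a powr of_real (n / 2) * bessel_integral n p a / 2) (at n)"
    by (intro tendsto_mult tendsto_divide tendsto_const tendsto_minus tendsto_ident_at pw bessel_integral_isCont_order[OF assms(1,2), of n, unfolded isCont_def] nz) simp_all
  moreover have "\<forall>\<^sub>F \<alpha> in at n. p powr of_real (- \<alpha> / 2) * a powr of_real (\<alpha> / 2) * bessel_integral \<alpha> p a / 2 = q \<alpha>"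
  proof -
    have "\<forall>\<^sub>F \<alpha> in at n. \<alpha> \<in> {n - 1<..<n + 1} - {n}"
      by (rule eventually_at_in_open) auto
    then show ?thesis
    proof eventually_elim
      case (elim \<alpha>)
      then show ?case unfolding q_def using assms by (intro bessel_K_quotient[symmetric]) auto
    qed
  qed
  ultimately have "(q \<longlongrightarrow> p powr of_real (- n / 2) * a powr of_real (n / 2) * bessel_integral n p a / 2) (at n)"
    by (rule Lim_transform_eventually)
  then have "Lim (at n) q = p powr of_real (- n / 2) * a powr of_real (n / 2) * bessel_integral n p a / 2"
    by (rule tendsto_Lim[rotated]) simp
  moreover have "n \<in> \<int>" using assms(3) by auto
  ultimately show ?thesis by (simp add: bessel_K_def q_def Let_def)
qed

lemma bessel_K_1:
  assumes "Re p > 0" "Re a > 0"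
  shows "2 * csqrt p * (bessel_K 1 (2 * csqrt (p * a)) / csqrt a) = bessel_integral 1 p a"
proof -
  have nz: "p \<noteq> 0" "a \<noteq> 0" using assms by auto
  have "p powr of_real (- 1 / 2) = inverse (csqrt p)" "a powr of_real (1 / 2) = csqrt a"
    unfolding csqrt_conv_powr by (simp_all add: powr_minus)
  then have K: "bessel_K 1 (2 * csqrt (p * a)) = inverse (csqrt p) * csqrt a * bessel_integral 1 p a / 2"
    using bessel_K_integral[OF assms, of 1] by (simp only: insert_iff simp_thms)
  show ?thesis unfolding K using nz by simp
qed

lemma bessel_K_2:
  assumes "Re p > 0" "Re a > 0"
  shows "2 * p * (bessel_K 2 (2 * csqrt (p * a)) / a) = bessel_integral 2 p a"
proof -
  have nz: "p \<noteq> 0" "a \<noteq> 0" using assms by auto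
  have "p powr of_real (- 2 / 2) = inverse p" "a powr of_real (2 / 2) = a"
    using nz by (simp_all add: powr_minus)
  then have K: "bessel_K 2 (2 * csqrt (p * a)) = inverse p * a * bessel_integral 2 p a / 2"
    using bessel_K_integral[OF assms, of 2] by (simp only: insert_iff simp_thms)
  show ?thesis unfolding K using nz by simp
qed

section \<open>Bessel functions of half-integer order and the Mathieu integrals\<close>

text \<open>
  These values turn the coefficients of the power series of \<open>J\<^bsub>-1/2\<^esub>\<close> and \<open>J\<^bsub>1/2\<^esub>\<close> into those of the
  cosine and the sine.
\<close>

lemma rGamma_half_integer:
  "rGamma (real m + 1 / 2) = fact m * 4 ^ m / (fact (2 * m) * sqrt pi)"
proof (induction m)
  case 0
  then show ?case by (simp add: rGamma_inverse_Gamma Gamma_one_half_real inverse_eq_divide)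
next
  case (Suc m)
  have "(real m + 1 / 2) * rGamma (real (Suc m) + 1 / 2) = rGamma (real m + 1 / 2)"
    using rGamma_plus1[of "real m + 1 / 2"] by (simp add: add_ac)
  then have "rGamma (real (Suc m) + 1 / 2) = rGamma (real m + 1 / 2) / (real m + 1 / 2)"
    by (simp add: field_simps)
  also have "\<dots> = fact (Suc m) * 4 ^ Suc m / (fact (2 * Suc m) * sqrt pi)"
    unfolding Suc.IH by (simp add: divide_simps) (simp add: algebra_simps)
  finally show ?case .
qed

lemma bessel_J_minus_half:
  assumes "x > 0"
  shows "bessel_J (- 1 / 2) (of_real x) = of_real ((x / 2) powr (- 1 / 2) * cos x / sqrt pi)"
proof -
  have "(- 1) ^ m * rGamma (real m + - 1 / 2 + 1) / fact m * (x / 2) ^ (2 * m) = (- 1) ^ m / fact (2 * m) * x ^ (2 * m) / sqrt pi" for m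
  proof -
    have e: "real m + - 1 / 2 + 1 = real m + 1 / 2" by simp
    show ?thesis unfolding e rGamma_half_integer by (simp add: power_divide power_mult)
  qed
  then have "(\<lambda>m. (- 1) ^ m * rGamma (real m + - 1 / 2 + 1) / fact m * (x / 2) ^ (2 * m)) sums (cos x / sqrt pi)"
    using sums_divide[OF cos_paired[of x], of "sqrt pi"] by simp
  from sums_unique[OF sums_of_real[OF this, where 'a = complex], symmetric]
  show ?thesis
    using assms powr_of_real[of "x / 2" "- 1 / 2"] by (simp add: bessel_J_def)
qed

lemma bessel_J_half:
  assumes "x > 0"
  shows "bessel_J (1 / 2) (of_real x) = of_real ((x / 2) powr (1 / 2) * (2 * sin x / (x * sqrt pi)))"
proof -
  have "(- 1) ^ m * rGamma (real m + 1 / 2 + 1) / fact m * (x / 2) ^ (2 * m) = (- 1) ^ m / fact (2 * m + 1) * x ^ (2 * m + 1) * (2 / (x * sqrt pi))" for m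
  proof -
    have "(real m + 1 / 2) * rGamma (real m + 1 / 2 + 1) = fact m * 4 ^ m / (fact (2 * m) * sqrt pi)"
      using rGamma_plus1[of "real m + 1 / 2"] rGamma_half_integer[of m] by simp
    moreover have nz: "real m + 1 / 2 \<noteq> 0" by (simp add: add_nonneg_eq_0_iff)
    ultimately have "rGamma (real m + 1 / 2 + 1) = fact m * 4 ^ m / (fact (2 * m) * sqrt pi) / (real m + 1 / 2)"
      by (subst nonzero_eq_divide_eq[OF nz]) (simp only: mult.commute)
    also have "\<dots> = 2 * fact m * 4 ^ m / (fact (2 * m + 1) * sqrt pi)"
      by (simp add: divide_simps)
    finally have "rGamma (real m + 1 / 2 + 1) = 2 * fact m * 4 ^ m / (fact (2 * m + 1) * sqrt pi)" .
    then show ?thesis using assms by (simp only:) (simp add: power_divide power_mult)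
  qed
  then have "(\<lambda>m. (- 1) ^ m * rGamma (real m + 1 / 2 + 1) / fact m * (x / 2) ^ (2 * m)) sums (sin x * (2 / (x * sqrt pi)))"
    using sums_mult2[OF sin_paired[of x], of "2 / (x * sqrt pi)"] by simp
  from sums_unique[OF sums_of_real[OF this, where 'a = complex], symmetric]
  show ?thesis
    using assms powr_of_real[of "x / 2" "1 / 2"] by (simp add: bessel_J_def mult_ac)
qed

lemma mathieu_S_0:
  assumes "\<gamma> > 0"
  shows "mathieu_S 0 p \<gamma> = (LBINT t:{0<..}. of_real (2 * cos (\<gamma> * t)) * exp (- (p / of_real t)) / of_real (exp t - 1))"
proof -
  have "of_real (sqrt pi / ((2 * \<gamma>) powr (0 - 1 / 2) * Gamma (0 + 1))) *
      (of_real (t powr (0 + 1 / 2)) * exp (- p / of_real t) / of_real (exp t - 1) * bessel_J (0 - 1 / 2) (of_real (\<gamma> * t))) =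
      of_real (2 * cos (\<gamma> * t)) * exp (- (p / of_real t)) / of_real (exp t - 1)" (is "of_real ?c * (of_real ?q * ?e / ?d * ?J) = _")
    if "t > 0" for t
  proof -
    let ?j = "(\<gamma> * t / 2) powr (- 1 / 2) * cos (\<gamma> * t) / sqrt pi"
    have J: "?J = of_real ?j"
      using bessel_J_minus_half[of "\<gamma> * t"] assms that by simp
    have "2 powr (1 / 2) * 2 powr (1 / 2) = (2::real)" by (simp flip: powr_add)
    then have "?c * ?q * ?j = 2 * cos (\<gamma> * t)"
      using assms that by (simp add: powr_minus powr_mult powr_divide field_simps)
    moreover have "of_real ?c * (of_real ?q * ?e / ?d * of_real ?j) = of_real (?c * ?q * ?j) * ?e / ?d"
      unfolding of_real_mult by (simp only: mult_ac times_divide_eq_left times_divide_eq_right)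
    ultimately show ?thesis unfolding J by (simp only:) simp
  qed
  then show ?thesis
    unfolding mathieu_S_def set_integral_mult_right[symmetric]
    by (intro set_lebesgue_integral_cong) auto
qed

lemma mathieu_S_1:
  assumes "\<gamma> > 0"
  shows "mathieu_S 1 p \<gamma> = (LBINT t:{0<..}. of_real (t * sin (\<gamma> * t) / \<gamma>) * exp (- (p / of_real t)) / of_real (exp t - 1))"
proof -
  have "of_real (sqrt pi / ((2 * \<gamma>) powr (1 - 1 / 2) * Gamma (1 + 1))) *
      (of_real (t powr (1 + 1 / 2)) * exp (- p / of_real t) / of_real (exp t - 1) * bessel_J (1 - 1 / 2) (of_real (\<gamma> * t))) =
      of_real (t * sin (\<gamma> * t) / \<gamma>) * exp (- (p / of_real t)) / of_real (exp t - 1)" (is "of_real ?c * (of_real ?q * ?e / ?d * ?J) = _")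
    if "t > 0" for t
  proof -
    let ?j = "(\<gamma> * t / 2) powr (1 / 2) * (2 * sin (\<gamma> * t) / (\<gamma> * t * sqrt pi))"
    have J: "?J = of_real ?j"
      using bessel_J_half[of "\<gamma> * t"] assms that by simp
    have "2 powr (1 / 2) * 2 powr (1 / 2) = (2::real)" "t powr (3 / 2) * t powr (1 / 2) = t * t"
      using that by (simp_all flip: powr_add add: power2_eq_square)
    moreover have "Gamma (2::real) = 1" using Gamma_fact[of 1, where 'a = real] by simp
    ultimately have "?c * ?q * ?j = t * sin (\<gamma> * t) / \<gamma>"
      using assms that by (simp add: powr_mult powr_divide field_simps)
    moreover have "of_real ?c * (of_real ?q * ?e / ?d * of_real ?j) = of_real (?c * ?q * ?j) * ?e / ?d"
      unfolding of_real_mult by (simp only: mult_ac times_divide_eq_left times_divide_eq_right)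
    ultimately show ?thesis unfolding J by (simp only:) simp
  qed
  then show ?thesis
    unfolding mathieu_S_def set_integral_mult_right[symmetric]
    by (intro set_lebesgue_integral_cong) auto
qed

section \<open>Expansion in the geometric series\<close>

lemma inverse_exp_minus_1_sums:
  assumes "t > (0::real)"
  shows "(\<lambda>k. exp (- (real (Suc k) * t))) sums (1 / (exp t - 1))"
proof -
  have "(\<lambda>k. exp (- t) * exp (- t) ^ k) sums (exp (- t) * (1 / (1 - exp (- t))))"
    using assms by (intro sums_mult geometric_sums) simp
  also have "exp (- t) * (1 / (1 - exp (- t))) = 1 / (exp t - 1)"
    using assms by (simp add: exp_minus field_simps)
  also have "(\<lambda>k. exp (- t) * exp (- t) ^ k) = (\<lambda>k. exp (- (real (Suc k) * t)))"
    by (auto simp: exp_of_nat_mult[symmetric] exp_add[symmetric] algebra_simps)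
  finally show ?thesis .
qed

text \<open>
  From \<open>e\<^bsup>t\<^esup> - 1 = (e\<^bsup>t/2\<^esup> - 1) (e\<^bsup>t/2\<^esup> + 1)\<close>. The bound is shaped to be absorbed into a Bessel kernel: the
  factor \<open>1 / t\<close> lowers the order by one and \<open>e\<^bsup>-t/2\<^esup>\<close> supplies the rate \<open>a = 1/2\<close>.
\<close>

lemma inverse_exp_minus_1_le:
  assumes "t > (0::real)"
  shows "1 / (exp t - 1) \<le> 2 * exp (- t / 2) / t"
proof -
  have "t / 2 \<le> exp (t / 2) - 1" using exp_ge_add_one_self[of "t / 2"] by linarith
  then have "t / 2 * exp (t / 2) \<le> (exp (t / 2) - 1) * (exp (t / 2) + 1)"
    using assms by (intro mult_mono) auto
  also have "\<dots> = exp t - 1" by (simp add: algebra_simps flip: exp_add)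
  finally have "t / 2 * exp (t / 2) \<le> exp t - 1" .
  then have "1 / (exp t - 1) \<le> 1 / (t / 2 * exp (t / 2))"
    using assms by (intro divide_left_mono) auto
  also have "\<dots> = 2 * exp (- t / 2) / t" by (simp add: exp_minus field_simps)
  finally show ?thesis .
qed

text \<open>
  Termwise integration of the geometric series for \<open>1 / (e\<^bsup>t\<^esup> - 1)\<close>. The choices \<open>\<sigma> = 1\<close> and
  \<open>\<sigma> = -1\<close> produce the cosine and the sine. All partial sums are dominated by one kernel of order \<open>s - 1\<close>, and the
  partial sums of the integrals converge.
\<close>

lemma bessel_integral_sums:
  fixes \<gamma> s :: real and p \<sigma> :: complex
  assumes p: "Re p > 0" and \<sigma>: "norm \<sigma> = 1"
  shows "(\<lambda>k. bessel_integral s p (of_nat (Suc k) - \<i> * of_real \<gamma>) + \<sigma> * bessel_integral s p (of_nat (Suc k) + \<i> * of_real \<gamma>))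
     sums (LBINT t:{0<..}. of_real (t powr (s - 1)) * (exp (\<i> * of_real (\<gamma> * t)) + \<sigma> * exp (- (\<i> * of_real (\<gamma> * t)))) *
             exp (- (p / of_real t)) / of_real (exp t - 1))"
proof -
  define h where "h = (\<lambda>t::real. of_real (t powr (s - 1)) * (exp (\<i> * of_real (\<gamma> * t)) + \<sigma> * exp (- (\<i> * of_real (\<gamma> * t)))) *
             exp (- (p / of_real t)))"
  define v where "v = (\<lambda>k::nat. of_nat (Suc k) - \<i> * of_real \<gamma> :: complex)"
  define u where "u = (\<lambda>k::nat. of_nat (Suc k) + \<i> * of_real \<gamma> :: complex)"
  define T where "T = (\<lambda>k t. bessel_kernel s p (v k) t + \<sigma> * bessel_kernel s p (u k) t)"
  have T: "T k t = h t * of_real (exp (- (real (Suc k) * t)))" for k t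
  proof -
    have "exp (- (p / of_real t) - v k * of_real t) = exp (- (p / of_real t)) * exp (\<i> * of_real (\<gamma> * t)) * exp (- (of_nat (Suc k) * of_real t))"
      "exp (- (p / of_real t) - u k * of_real t) = exp (- (p / of_real t)) * exp (- (\<i> * of_real (\<gamma> * t))) * exp (- (of_nat (Suc k) * of_real t))"
      unfolding exp_add[symmetric] u_def v_def by (auto intro!: arg_cong[where f = exp] simp: algebra_simps)
    then show ?thesis
      unfolding T_def h_def bessel_kernel_def by (simp add: algebra_simps flip: exp_of_real)
  qed
  have adm: "bessel_admissible s p (v k)" "bessel_admissible s p (u k)" for k
    using p by (simp_all add: bessel_admissible_def u_def v_def)
  note int = bessel_kernel_integrable[OF adm(1)] set_integrable_mult_right[OF bessel_kernel_integrable[OF adm(2)], where a = \<sigma>]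
  have T_int: "set_integrable lborel {0<..} (T k)" for k
    unfolding T_def by (intro set_integral_add int)
  have T_integral: "(LBINT t:{0<..}. T k t) = bessel_integral s p (v k) + \<sigma> * bessel_integral s p (u k)" for k
    unfolding T_def using int[of k] by (simp add: set_integral_add bessel_integral_def)
  have S_integral: "(LBINT t:{0<..}. (\<Sum>k<N. T k t)) = (\<Sum>k<N. bessel_integral s p (v k) + \<sigma> * bessel_integral s p (u k))" for N
    unfolding T_integral[symmetric] using T_int
    unfolding set_lebesgue_integral_def set_integrable_def scaleR_sum_right by (rule Bochner_Integration.integral_sum)
  have S_meas: "set_borel_measurable lborel {0<..} (\<lambda>t. \<Sum>k<N. T k t)" for N
    using T_int unfolding set_borel_measurable_def set_integrable_def scaleR_sum_right
    by (intro borel_measurable_sum borel_measurable_integrable)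
  have h_le: "norm (h t) \<le> 2 * t powr (s - 1) * exp (- (Re p / t))" if "t > 0" for t
  proof -
    have "norm (exp (\<i> * of_real (\<gamma> * t)) + \<sigma> * exp (- (\<i> * of_real (\<gamma> * t)))) \<le> 2"
      by (rule order_trans[OF norm_triangle_ineq]) (simp add: norm_mult \<sigma>)
    then have "t powr (s - 1) * norm (exp (\<i> * of_real (\<gamma> * t)) + \<sigma> * exp (- (\<i> * of_real (\<gamma> * t)))) * exp (- (Re p / t)) \<le>
        t powr (s - 1) * 2 * exp (- (Re p / t))"
      by (intro mult_right_mono mult_left_mono) auto
    then show ?thesis unfolding h_def norm_mult by (simp add: mult_ac)
  qed
  have "(\<lambda>N. LBINT t:{0<..}. (\<Sum>k<N. T k t)) \<longlonglongrightarrow> (LBINT t:{0<..}. h t / of_real (exp t - 1))"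
  proof (rule set_integral_dominated_convergence_sequence[where w = "\<lambda>t. 4 * norm (bessel_kernel (s - 1) p (1 / 2) t)"])
    show "set_integrable lborel {0<..} (\<lambda>t. 4 * norm (bessel_kernel (s - 1) p (1 / 2) t))"
      using p by (intro set_integrable_mult_right set_integrable_norm bessel_kernel_integrable) (simp add: bessel_admissible_def)
    show "set_borel_measurable lborel {0<..} (\<lambda>t. h t / of_real (exp t - 1))"
      unfolding set_borel_measurable_def h_def by measurable
    fix t :: real assume "t \<in> {0<..}"
    then have t: "t > 0" by simp
    note sums = inverse_exp_minus_1_sums[OF t]
    have S: "(\<Sum>k<N. T k t) = h t * of_real (\<Sum>k<N. exp (- (real (Suc k) * t)))" for N
      by (simp add: T sum_distrib_left)
    show "(\<lambda>N. \<Sum>k<N. T k t) \<longlonglongrightarrow> h t / of_real (exp t - 1)"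
      using sums_mult[OF sums_of_real[OF sums, where 'a = complex], of "h t"] unfolding sums_def by (simp add: T)
    fix N
    have "(\<Sum>k<N. exp (- (real (Suc k) * t))) \<le> 1 / (exp t - 1)"
      using sums by (metis exp_ge_zero sum_le_suminf sums_iff finite_lessThan)
    also have "\<dots> \<le> 2 * exp (- t / 2) / t" by (rule inverse_exp_minus_1_le[OF t])
    finally have le: "(\<Sum>k<N. exp (- (real (Suc k) * t))) \<le> 2 * exp (- t / 2) / t" .
    have "norm (\<Sum>k<N. T k t) = norm (h t) * (\<Sum>k<N. exp (- (real (Suc k) * t)))"
      unfolding S norm_mult norm_of_real by (simp add: sum_nonneg)
    also have "\<dots> \<le> (2 * t powr (s - 1) * exp (- (Re p / t))) * (2 * exp (- t / 2) / t)"
      using h_le[OF t] le t by (intro mult_mono) (auto intro: sum_nonneg)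
    also have "\<dots> = 4 * norm (bessel_kernel (s - 1) p (1 / 2) t)"
    proof -
      have "exp (- (Re p / t) - Re (1 / 2) * t) = exp (- (Re p / t)) * exp (- t / 2)" by (simp flip: exp_add)
      moreover have "t powr (s - 1 - 1) = t powr (s - 1) / t"
        using t by (simp add: powr_diff power2_eq_square)
      ultimately show ?thesis unfolding norm_bessel_kernel[OF t] by simp
    qed
    finally show "norm (\<Sum>k<N. T k t) \<le> \<dots>" .
  qed (rule S_meas)
  then show ?thesis
    unfolding S_integral sums_def h_def u_def v_def .
qed

theorem theorem3:
  fixes p :: complex and \<gamma> :: real
  assumes "Re p > 0" and "\<gamma> > 0"
  defines "u \<equiv> (\<lambda>k::nat. of_nat (Suc k) + \<i> * of_real \<gamma> :: complex)"
    and "v \<equiv> (\<lambda>k::nat. of_nat (Suc k) - \<i> * of_real \<gamma> :: complex)"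
  defines "f \<equiv> (\<lambda>k. bessel_K 1 (2 * csqrt (p * u k)) / csqrt (u k)
                    + bessel_K 1 (2 * csqrt (p * v k)) / csqrt (v k))"
    and "g \<equiv> (\<lambda>k. bessel_K 2 (2 * csqrt (p * u k)) / u k
                    - bessel_K 2 (2 * csqrt (p * v k)) / v k)"
  shows "summable f \<and> mathieu_S 0 p \<gamma> = 2 * csqrt p * (\<Sum>k. f k) \<and>
         summable g \<and> mathieu_S 1 p \<gamma> = p * \<i> / of_real \<gamma> * (\<Sum>k. g k)"
proof -
  have uv: "Re (u k) > 0" "Re (v k) > 0" for k by (simp_all add: u_def v_def)
  have p: "p \<noteq> 0" using assms(1) by auto
  have cos: "exp (\<i> * of_real x) + 1 * exp (- (\<i> * of_real x)) = of_real (2 * cos x)" for x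
    using cos_exp_eq[of "of_real x"] by (simp add: mult.commute flip: cos_of_real)
  have sin: "exp (\<i> * of_real x) + - 1 * exp (- (\<i> * of_real x)) = 2 * \<i> * of_real (sin x)" for x
    using sin_exp_eq[of "of_real x"] by (simp flip: sin_of_real add: field_simps)
  have "(\<lambda>k. bessel_integral 1 p (v k) + 1 * bessel_integral 1 p (u k)) sums
      (LBINT t:{0<..}. of_real (t powr (1 - 1)) * (exp (\<i> * of_real (\<gamma> * t)) + 1 * exp (- (\<i> * of_real (\<gamma> * t)))) *
             exp (- (p / of_real t)) / of_real (exp t - 1))"
    unfolding u_def v_def using assms(1) by (intro bessel_integral_sums) auto
  also have "(LBINT t:{0<..}. of_real (t powr (1 - 1)) * (exp (\<i> * of_real (\<gamma> * t)) + 1 * exp (- (\<i> * of_real (\<gamma> * t)))) *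
             exp (- (p / of_real t)) / of_real (exp t - 1)) = mathieu_S 0 p \<gamma>"
    unfolding mathieu_S_0[OF assms(2)] cos by (intro set_lebesgue_integral_cong) auto
  also have "(\<lambda>k. bessel_integral 1 p (v k) + 1 * bessel_integral 1 p (u k)) = (\<lambda>k. 2 * csqrt p * f k)"
    using assms(1) uv by (simp add: bessel_K_1[symmetric] f_def algebra_simps)
  finally have "(\<lambda>k. 2 * csqrt p * f k) sums mathieu_S 0 p \<gamma>" .
  then have f: "f sums (mathieu_S 0 p \<gamma> / (2 * csqrt p))"
    using p sums_mult_D[of "2 * csqrt p" f] by fastforce
  have "(\<lambda>k. bessel_integral 2 p (v k) + - 1 * bessel_integral 2 p (u k)) sums
      (LBINT t:{0<..}. of_real (t powr (2 - 1)) * (exp (\<i> * of_real (\<gamma> * t)) + - 1 * exp (- (\<i> * of_real (\<gamma> * t)))) *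
             exp (- (p / of_real t)) / of_real (exp t - 1))"
    unfolding u_def v_def using assms(1) by (intro bessel_integral_sums) auto
  also have "(LBINT t:{0<..}. of_real (t powr (2 - 1)) * (exp (\<i> * of_real (\<gamma> * t)) + - 1 * exp (- (\<i> * of_real (\<gamma> * t)))) *
             exp (- (p / of_real t)) / of_real (exp t - 1)) = 2 * \<i> * of_real \<gamma> * mathieu_S 1 p \<gamma>"
    unfolding mathieu_S_1[OF assms(2)] sin set_integral_mult_right[symmetric] using assms(2)
    by (intro set_lebesgue_integral_cong) (auto simp: field_simps)
  also have "(\<lambda>k. bessel_integral 2 p (v k) + - 1 * bessel_integral 2 p (u k)) = (\<lambda>k. - (2 * p) * g k)"
    using assms(1) uv by (simp add: bessel_K_2[symmetric] g_def algebra_simps)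
  finally have "(\<lambda>k. - (2 * p) * g k) sums (2 * \<i> * of_real \<gamma> * mathieu_S 1 p \<gamma>)" .
  then have g: "g sums (2 * \<i> * of_real \<gamma> * mathieu_S 1 p \<gamma> / (- (2 * p)))"
    using p sums_mult_D[of "- (2 * p)" g] by fastforce
  show ?thesis
    using f g p assms(2) by (auto simp: sums_iff field_simps)
qed

end
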